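(* Let $K$ be a field of characteristic zero and let $G$ be a Keller map over $K$ whose Jacobian matrix is symmetric. Write $G_i^{(1)}$ for the linear part (homogeneous part of degree 1) of $G_i$. i) Suppose $G\in K[x]^n$, $x=(x_1,\dots,x_n)$, and let $i$ be an index with $\frac{\partial}{\partial x_i}G_i^{(1)}\neq 0$. If $G_i-G_i^{(1)}$ is homogeneous, then $G_i$ is irreducible; if $G_i-G_i^{(1)}$ is cubic homogeneous, then $G_i+c$ is irreducible for all $c\in K$. ii) Suppose $G\in K[x,y]^{2n}$, $y=(y_1,\dots,y_n)$, and $G$ is of the form $$G=\nabla_{x,y}\big(f(x+uy)+(x+u'y)^{\mathsf T}F(x+uy)\big),$$ where $u,u'\in K$ with $u\neq 0$, $f\in K[x]$ and $F\in K[x]^n$. Then $G_i$ is irreducible for all $i$. Furthermore, in this case $u\neq u'$, $F$ is a Keller map, and $F$ is invertible if and only if $G$ is invertible.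
   Context: A Keller map is a polynomial map $P$ in $m$ variables with $m$ components such that $\det\mathcal{J}P\in K^{*}$, where $\mathcal{J}$ is the Jacobian matrix. $\nabla_{x,y}$ is the gradient (column vector of partial derivatives) with respect to $x_1,\dots,x_n,y_1,\dots,y_n$; $f(x+uy)$ denotes substitution of $x_j+uy_j$ for $x_j$. *)

theory Defs
  imports "HOL-Library.Poly_Mapping" "HOL-Computational_Algebra.Factorial_Ring"
    "HOL-Combinatorics.Permutations"
begin

type_synonym 'a mpoly = "(nat \<Rightarrow>\<^sub>0 nat) \<Rightarrow>\<^sub>0 'a"

definition Var :: "nat \<Rightarrow> 'a::comm_ring_1 mpoly" where
  "Var v = Poly_Mapping.single (Poly_Mapping.single v 1) 1"

definition Const :: "'a::comm_ring_1 \<Rightarrow> 'a mpoly" where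
  "Const c = Poly_Mapping.single 0 c"

definition vars :: "'a::comm_ring_1 mpoly \<Rightarrow> nat set" where
  "vars p = \<Union> (Poly_Mapping.keys ` Poly_Mapping.keys p)"

definition tdeg :: "(nat \<Rightarrow>\<^sub>0 nat) \<Rightarrow> nat" where
  "tdeg m = (\<Sum>v\<in>Poly_Mapping.keys m. Poly_Mapping.lookup m v)"

definition pd :: "nat \<Rightarrow> 'a::comm_ring_1 mpoly \<Rightarrow> 'a mpoly" where
  "pd v p = (\<Sum>m\<in>Poly_Mapping.keys p.
     Poly_Mapping.single (m - Poly_Mapping.single v 1)
       (Poly_Mapping.lookup p m * of_nat (Poly_Mapping.lookup m v)))"

definition subst :: "(nat \<Rightarrow> 'a::comm_ring_1 mpoly) \<Rightarrow> 'a mpoly \<Rightarrow> 'a mpoly" where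
  "subst s p = (\<Sum>m\<in>Poly_Mapping.keys p.
     Const (Poly_Mapping.lookup p m) * (\<Prod>v\<in>Poly_Mapping.keys m. s v ^ Poly_Mapping.lookup m v))"

definition homog_part :: "nat \<Rightarrow> 'a::comm_ring_1 mpoly \<Rightarrow> 'a mpoly" where
  "homog_part d p = (\<Sum>m\<in>{m\<in>Poly_Mapping.keys p. tdeg m = d}.
     Poly_Mapping.single m (Poly_Mapping.lookup p m))"

definition homogeneous :: "nat \<Rightarrow> 'a::comm_ring_1 mpoly \<Rightarrow> bool" where
  "homogeneous d p \<longleftrightarrow> (\<forall>m\<in>Poly_Mapping.keys p. tdeg m = d)"

definition polymap :: "nat \<Rightarrow> (nat \<Rightarrow> 'a::comm_ring_1 mpoly) \<Rightarrow> bool" where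
  "polymap m G \<longleftrightarrow> (\<forall>i<m. vars (G i) \<subseteq> {..<m})"

definition jac_det :: "nat \<Rightarrow> (nat \<Rightarrow> 'a::comm_ring_1 mpoly) \<Rightarrow> 'a mpoly" where
  "jac_det m G = (\<Sum>\<pi> | \<pi> permutes {..<m}.
     of_int (sign \<pi>) * (\<Prod>i<m. pd (\<pi> i) (G i)))"

definition keller :: "nat \<Rightarrow> (nat \<Rightarrow> 'a::comm_ring_1 mpoly) \<Rightarrow> bool" where
  "keller m G \<longleftrightarrow> polymap m G \<and> (\<exists>c. c \<noteq> 0 \<and> jac_det m G = Const c)"

definition jac_symmetric :: "nat \<Rightarrow> (nat \<Rightarrow> 'a::comm_ring_1 mpoly) \<Rightarrow> bool" where
  "jac_symmetric m G \<longleftrightarrow> (\<forall>i<m. \<forall>j<m. pd j (G i) = pd i (G j))"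

definition invertible_polymap :: "nat \<Rightarrow> (nat \<Rightarrow> 'a::comm_ring_1 mpoly) \<Rightarrow> bool" where
  "invertible_polymap m G \<longleftrightarrow> polymap m G \<and>
     (\<exists>H. polymap m H \<and> (\<forall>i<m. subst G (H i) = Var i) \<and> (\<forall>i<m. subst H (G i) = Var i))"

end

theory Submission
  imports Defs "Jordan_Normal_Form.Determinant"
begin

text \<open>
  Let \<open>W\<close> be the adjugate of the Jacobian of \<open>G\<close>.  Since the Jacobian determinant is constant and
  the Jacobian is symmetric, Jacobi's formula gives a second-order equation
  \<open>\<Sum> W\<^sub>k\<^sub>j \<partial>\<^sub>j\<partial>\<^sub>k G\<^sub>i = 0\<close> for the single component \<open>G\<^sub>i\<close>, next to the first-order equations
  \<open>\<Sum> W\<^sub>k\<^sub>j \<partial>\<^sub>k G\<^sub>i = c \<delta>\<^sub>i\<^sub>j\<close>.  If \<open>G\<^sub>i = A U\<close> with \<open>A\<close> affine and \<open>\<partial>\<^sub>i A \<noteq> 0\<close>, expanding both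
  along the hyperplane \<open>A = 0\<close> forces \<open>U\<close> to be constant.  Any factorisation in (i) produces such an
  affine factor, except for one in the cubic case whose two factors have a common zero, where
  the \<open>i\<close>-th row of the Jacobian would vanish.

  In (ii), with \<open>X = x + uy\<close> and \<open>Y = x + u'y\<close>, the components of \<open>G\<close> are linear combinations of
  \<open>F\<^sub>i(X)\<close> and \<open>A\<^sub>i = \<partial>\<^sub>i f(X) + \<Sum> Y\<^sub>j \<partial>\<^sub>i F\<^sub>j(X)\<close>.  The Hessian in these coordinates is a block matrix with a zero
  block, whence the Jacobian determinant of \<open>G\<close> is a constant times the square of that of \<open>F\<close> at \<open>X\<close>.
  Each component has degree one in \<open>Y\<close> and its \<open>Y\<close>-coefficients form a unimodular row, so it is
  irreducible; inverses are obtained by solving for \<open>X\<close> and then linearly for \<open>Y\<close>.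
\<close>

abbreviation "lookup \<equiv> Poly_Mapping.lookup"
abbreviation "keys \<equiv> Poly_Mapping.keys"
abbreviation "single \<equiv> Poly_Mapping.single"

subsection \<open>Evaluation homomorphisms\<close>

definition mval :: "(nat \<Rightarrow> 'b::comm_monoid_mult) \<Rightarrow> (nat \<Rightarrow>\<^sub>0 nat) \<Rightarrow> 'b" where
  "mval s m = (\<Prod>v\<in>keys m. s v ^ lookup m v)"

text \<open>The coefficient map \<open>\<kappa>\<close> and the target ring are kept general so that
  \<open>subst\<close> and the later maps \<open>tpoly\<close> and \<open>ypoly\<close> into
  univariate polynomials are all instances and inherit the homomorphism laws from one proof.\<close>

definition ev :: "('a::comm_ring_1 \<Rightarrow> 'b::comm_ring_1) \<Rightarrow> (nat \<Rightarrow> 'b) \<Rightarrow> 'a mpoly \<Rightarrow> 'b" where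
  "ev \<kappa> s p = (\<Sum>m\<in>keys p. \<kappa> (lookup p m) * mval s m)"

lemma subst_eq_ev: "subst s = ev Const s"
  by (simp add: fun_eq_iff subst_def ev_def mval_def)

lemma mval_superset:
  assumes "finite V" "keys m \<subseteq> V"
  shows "mval s m = (\<Prod>v\<in>V. s v ^ lookup m v)"
  unfolding mval_def using assms
  by (intro prod.mono_neutral_left) (auto simp: in_keys_iff)

lemma mval_add: "mval s (a + b) = mval s a * mval s b"
proof -
  let ?V = "keys a \<union> keys b"
  have "keys (a + b) \<subseteq> ?V" by (rule keys_add)
  then show ?thesis
    by (simp add: mval_superset[of ?V] lookup_add power_add prod.distrib)
qed

lemma mval_0 [simp]: "mval s 0 = 1"
  by (simp add: mval_def)

lemma mval_single [simp]: "mval s (single v k) = s v ^ k"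
  by (simp add: mval_def)

lemma sum_single_keys: "(\<Sum>m\<in>keys p. single m (lookup p m)) = p"
proof (rule poly_mapping_eqI)
  fix k
  have "lookup (\<Sum>m\<in>keys p. single m (lookup p m)) k
      = (\<Sum>m\<in>keys p. (if m = k then lookup p m else 0))"
    by (simp add: lookup_sum lookup_single when_def)
  also have "\<dots> = lookup p k"
    by (simp add: in_keys_iff)
  finally show "lookup (\<Sum>m\<in>keys p. single m (lookup p m)) k = lookup p k" .
qed

lemma mpoly_additive_induct [case_names zero single add]:
  assumes "P 0" "\<And>m c. P (single m c)" "\<And>p q. P p \<Longrightarrow> P q \<Longrightarrow> P (p + q)"
  shows "P (p :: 'k \<Rightarrow>\<^sub>0 'a::comm_monoid_add)"
proof -
  have "P (\<Sum>m\<in>A. single m (lookup p m))" if "finite A" for A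
    using that by (induction A) (auto intro: assms)
  from this[of "keys p"] show ?thesis by (simp add: sum_single_keys)
qed

lemma ev_superset:
  assumes "finite M" "keys p \<subseteq> M" "\<kappa> 0 = 0"
  shows "ev \<kappa> s p = (\<Sum>m\<in>M. \<kappa> (lookup p m) * mval s m)"
  unfolding ev_def using assms
  by (intro sum.mono_neutral_left) (auto simp: in_keys_iff)

lemma ev_single: "\<kappa> 0 = 0 \<Longrightarrow> ev \<kappa> s (single m c) = \<kappa> c * mval s m"
  by (simp add: ev_def)

lemma ev_0 [simp]: "ev \<kappa> s 0 = 0"
  by (simp add: ev_def)

context comm_ring_hom
begin

lemma ev_1: "ev hom s 1 = 1"
  by (simp add: ev_def lookup_one)

lemma ev_add: "ev hom s (p + q) = ev hom s p + ev hom s q"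
proof -
  let ?M = "keys p \<union> keys q"
  have "keys (p + q) \<subseteq> ?M" by (rule keys_add)
  then show ?thesis
    by (simp add: ev_superset[of ?M] lookup_add hom_add sum.distrib distrib_right)
qed

lemma ev_mult: "ev hom s (p * q) = ev hom s p * ev hom s q"
proof (induction p rule: mpoly_additive_induct)
  case (single m c)
  show ?case
  proof (induction q rule: mpoly_additive_induct)
    case (single n d)
    show ?case by (simp only: mult_single ev_single[of hom, OF hom_zero] mval_add hom_mult mult_ac)
  qed (simp_all add: ev_add distrib_left)
qed (simp_all add: ev_add distrib_right)

lemma ev_hom: "comm_ring_hom (ev hom s)"
  by unfold_locales (auto simp: ev_add ev_mult ev_1)

lemma ev_Const [simp]: "ev hom s (Const c) = hom c"
  by (simp add: Const_def ev_single)

lemma ev_Var [simp]: "ev hom s (Var v) = s v"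
  by (simp add: Var_def ev_single)

end

lemma Const_hom: "comm_ring_hom (Const :: 'a::comm_ring_1 \<Rightarrow> 'a mpoly)"
  by unfold_locales (auto simp: Const_def single_add mult_single)

interpretation Const: comm_ring_hom "Const :: 'a::comm_ring_1 \<Rightarrow> 'a mpoly"
  by (rule Const_hom)

interpretation subst: comm_ring_hom "subst s" for s :: "nat \<Rightarrow> 'a::comm_ring_1 mpoly"
  unfolding subst_eq_ev by (rule Const.ev_hom)

lemma subst_Const [simp]: "subst s (Const c) = Const c"
  and subst_Var [simp]: "subst s (Var v) = s v"
  by (simp_all add: subst_eq_ev)

lemma Const_eq_iff [simp]: "Const a = Const b \<longleftrightarrow> a = b"
  by (metis Const_def lookup_single_eq)

lemma Const_eq_0_iff [simp]: "Const a = 0 \<longleftrightarrow> a = 0"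
  using Const_eq_iff[of a 0] by simp

lemma Const_inverse: "(c::'a::field) \<noteq> 0 \<Longrightarrow> Const c * Const (inverse c) = 1"
  by (simp flip: Const.hom_mult)

lemma mval_Var: "mval Var m = single m (1::'a::comm_ring_1)"
proof -
  have "(\<Prod>v\<in>A. Var v ^ f v) = single (\<Sum>v\<in>A. single v (f v)) (1::'a)" if "finite A" for A f
    using that
  proof (induction A)
    case (insert v A)
    have "Var v ^ k = single (single v k) (1::'a)" for k
      by (induction k) (simp_all add: Var_def mult_single flip: single_add)
    with insert show ?case by (simp add: mult_single)
  qed simp
  then show ?thesis by (simp add: mval_def sum_single_keys)
qed

lemma single_conv_mval: "single m c = Const c * mval Var m"
  by (simp add: mval_Var Const_def mult_single)

text \<open>Constants and the variables in \<open>V\<close> generate every polynomial in these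
  variables as a ring. Statements about homomorphisms and derivations then only need checking on
  generators, with control over which variables occur.\<close>

lemma mpoly_induct [consumes 1, case_names Const Var add mult]:
  assumes "vars p \<subseteq> V" and C: "\<And>c. P (Const c)" and V: "\<And>v. v \<in> V \<Longrightarrow> P (Var v)"
    and add: "\<And>p q. P p \<Longrightarrow> P q \<Longrightarrow> P (p + q)" and mult: "\<And>p q. P p \<Longrightarrow> P q \<Longrightarrow> P (p * q)"
  shows "P (p :: 'a::comm_ring_1 mpoly)"
proof -
  have P1: "P 1" using C[of 1] by simp
  have pow: "P (q ^ k)" if "P q" for q k
    by (induction k) (auto intro: P1 mult that)
  have prod: "P (\<Prod>v\<in>A. Var v ^ f v)" if "finite A" "A \<subseteq> V" for A f
    using that by (induction A) (auto intro: P1 mult pow V)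
  have mono: "P (single m c)" if "keys m \<subseteq> V" for m c
    unfolding single_conv_mval mval_def by (intro mult C prod that) simp
  have "P (\<Sum>m\<in>A. single m (lookup p m))" if "finite A" "A \<subseteq> keys p" for A
    using that
  proof (induction A)
    case empty
    show ?case using C[of 0] by simp
  next
    case (insert m A)
    then have "keys m \<subseteq> V" using assms(1) by (auto simp: vars_def)
    with insert show ?case by (auto intro: add mono)
  qed
  from this[of "keys p"] show ?thesis by (simp add: sum_single_keys)
qed

lemma mpoly_hom_eqI:
  assumes "comm_ring_hom h" "comm_ring_hom k" "vars p \<subseteq> V"
    and "\<And>c. h (Const c) = k (Const c)" "\<And>v. v \<in> V \<Longrightarrow> h (Var v) = k (Var v)"
  shows "h p = k (p :: 'a::comm_ring_1 mpoly)"
proof -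
  interpret h: comm_ring_hom h by fact
  interpret k: comm_ring_hom k by fact
  show ?thesis using assms(3)
    by (induction p rule: mpoly_induct) (simp_all add: assms(4,5) h.hom_add k.hom_add h.hom_mult k.hom_mult)
qed

lemma subst_cong:
  assumes "vars p \<subseteq> V" "\<And>v. v \<in> V \<Longrightarrow> s v = t v"
  shows "subst s p = subst t p"
  by (rule mpoly_hom_eqI[OF subst.comm_ring_hom_axioms subst.comm_ring_hom_axioms assms(1)])
    (simp_all add: assms(2))

lemma comm_ring_hom_comp:
  assumes "comm_ring_hom h" "comm_ring_hom k"
  shows "comm_ring_hom (\<lambda>x. h (k x))"
proof -
  interpret h: comm_ring_hom h by fact
  interpret k: comm_ring_hom k by fact
  show ?thesis
    by unfold_locales (simp_all add: k.hom_add h.hom_add k.hom_mult h.hom_mult)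
qed

lemma subst_subst: "subst s (subst t p) = subst (\<lambda>v. subst s (t v)) p"
  using mpoly_hom_eqI[OF comm_ring_hom_comp[OF subst.comm_ring_hom_axioms[of s]
      subst.comm_ring_hom_axioms[of t]] subst.comm_ring_hom_axioms subset_UNIV,
      of "\<lambda>v. subst s (t v)" p]
  by simp

lemma comm_ring_hom_ident: "comm_ring_hom (\<lambda>x. x)"
  by unfold_locales simp_all

lemma subst_id:
  assumes "vars p \<subseteq> V" "\<And>v. v \<in> V \<Longrightarrow> s v = Var v"
  shows "subst s p = p"
  using mpoly_hom_eqI[OF subst.comm_ring_hom_axioms comm_ring_hom_ident assms(1), of s]
  by (simp add: assms(2))

section \<open>Variables occurring in a polynomial\<close>

lemma vars_Const [simp]: "vars (Const c) = {}"
  by (auto simp: vars_def Const_def)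

lemma vars_0 [simp]: "vars 0 = {}"
  by (simp add: vars_def)

lemma vars_1 [simp]: "vars 1 = {}"
  by (simp add: vars_def)

lemma vars_Var [simp]: "vars (Var v :: 'a::comm_ring_1 mpoly) = {v}"
  by (auto simp: vars_def Var_def)

lemma vars_add: "vars (p + q) \<subseteq> vars p \<union> vars q"
  using keys_add[of p q] by (auto simp: vars_def)

lemma vars_uminus [simp]: "vars (- p) = vars p"
  by (simp add: vars_def)

lemma vars_diff: "vars (p - q) \<subseteq> vars p \<union> vars q"
  using vars_add[of p "- q"] by simp

lemma vars_mult: "vars (p * q) \<subseteq> vars p \<union> vars q"
proof
  fix v assume "v \<in> vars (p * q)"
  then obtain m where m: "m \<in> keys (p * q)" "v \<in> keys m" by (auto simp: vars_def)
  from m(1) keys_mult[of p q] obtain a b where "m = a + b" "a \<in> keys p" "b \<in> keys q" by auto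
  with m(2) keys_add[of a b] show "v \<in> vars p \<union> vars q" by (auto simp: vars_def)
qed

lemma vars_sum: "vars (\<Sum>i\<in>A. f i) \<subseteq> (\<Union>i\<in>A. vars (f i))"
proof (cases "finite A")
  case True
  then show ?thesis
  proof induction
    case (insert i A)
    then show ?case using vars_add[of "f i" "sum f A"] by auto
  qed simp
qed simp

lemma vars_subst:
  assumes "vars p \<subseteq> V" "\<And>v. v \<in> V \<Longrightarrow> vars (s v) \<subseteq> W"
  shows "vars (subst s p) \<subseteq> W"
  using assms(1)
proof (induction p rule: mpoly_induct)
  case (add p q) then show ?case using vars_add[of "subst s p" "subst s q"] by (auto simp: subst.hom_add)
next
  case (mult p q) then show ?case using vars_mult[of "subst s p" "subst s q"] by (auto simp: subst.hom_mult)
qed (use assms in auto)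

lemma finite_vars [simp]: "finite (vars p)"
  by (simp add: vars_def)

subsection \<open>Partial derivatives\<close>

lemma lookup_pd: "lookup (pd v p) m = lookup p (m + single v 1) * of_nat (Suc (lookup m v))"
proof -
  \<comment> \<open>Subtraction of exponents is truncated, so \<open>k - single v 1\<close> also
    arises from monomials without \<open>v\<close>; these carry the factor
    \<open>of_nat 0\<close>.\<close>
  have *: "lookup (single (k - single v 1) (c * of_nat (lookup k v))) m =
      (if k = m + single v 1 then c * of_nat (lookup k v) else 0)" for k and c :: 'a
  proof (cases "lookup k v = 0")
    case True
    then have "k \<noteq> m + single v 1" by (auto simp: lookup_add)
    with True show ?thesis by simp
  next
    case False
    have "k - single v 1 = m \<longleftrightarrow> k = m + single v 1"
    proof
      assume "k - single v 1 = m"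
      then have "lookup m u = lookup k u - lookup (single v 1) u" for u
        by (auto simp: lookup_minus)
      with False have "lookup (m + single v 1) u = lookup k u" for u
        by (cases "u = v") (simp_all add: lookup_add lookup_single)
      then show "k = m + single v 1" by (metis poly_mapping_eqI)
    qed simp
    then show ?thesis by (simp add: lookup_single when_def)
  qed
  have "lookup (pd v p) m = (\<Sum>k\<in>keys p. if k = m + single v 1
      then lookup p k * of_nat (lookup k v) else 0)"
    by (simp only: pd_def lookup_sum *)
  also have "\<dots> = lookup p (m + single v 1) * of_nat (lookup (m + single v 1) v)"
    by (simp add: in_keys_iff)
  finally show ?thesis by (simp add: lookup_add)
qed

lemma pd_add: "pd v (p + q) = pd v p + pd v q"
  by (intro poly_mapping_eqI) (simp add: lookup_pd lookup_add distrib_right)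

lemma pd_0 [simp]: "pd v 0 = 0"
  by (simp add: pd_def)

lemma pd_uminus: "pd v (- p) = - pd v p"
  by (intro poly_mapping_eqI) (simp add: lookup_pd)

lemma pd_diff: "pd v (p - q) = pd v p - pd v q"
  using pd_add[of v p "- q"] by (simp add: pd_uminus)

lemma pd_sum: "pd v (\<Sum>i\<in>A. f i) = (\<Sum>i\<in>A. pd v (f i))"
  by (induction A rule: infinite_finite_induct) (simp_all add: pd_add)

lemma pd_single: "pd v (single m c) = single (m - single v 1) (c * of_nat (lookup m v))"
  by (simp add: pd_def)

lemma pd_mult: "pd v (p * q) = pd v p * q + p * pd v q"
proof (induction p rule: mpoly_additive_induct)
  case (single m c)
  show ?case
  proof (induction q rule: mpoly_additive_induct)
    case (single n d)
    \<comment> \<open>Truncated subtraction commutes past the addition of \<open>n\<close> only if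
      \<open>v\<close> has positive exponent in \<open>m\<close>; otherwise both sides are zero
      because of the numerical factor.\<close>
    have A: "single (m + n - single v 1) (c * d * of_nat (lookup m v))
        = single (m - single v 1) (c * of_nat (lookup m v)) * single n d"
    proof (cases "lookup m v = 0")
      case False
      then have "m + n - single v 1 = (m - single v 1) + n"
        by (intro poly_mapping_eqI) (auto simp: lookup_add lookup_minus lookup_single when_def)
      then show ?thesis by (simp add: mult_single mult_ac add_ac)
    qed simp
    have B: "single (m + n - single v 1) (c * d * of_nat (lookup n v))
        = single m c * single (n - single v 1) (d * of_nat (lookup n v))"
    proof (cases "lookup n v = 0")
      case False
      then have "m + n - single v 1 = m + (n - single v 1)"
        by (intro poly_mapping_eqI) (auto simp: lookup_add lookup_minus lookup_single when_def)
      then show ?thesis by (simp add: mult_single mult_ac add_ac)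
    qed simp
    have "pd v (single m c * single n d) = single (m + n - single v 1) (c * d * of_nat (lookup m v))
        + single (m + n - single v 1) (c * d * of_nat (lookup n v))"
      by (simp add: mult_single pd_single lookup_add distrib_left flip: single_add)
    then show ?case by (simp only: A B pd_single)
  qed (simp_all add: pd_add distrib_left)
qed (simp_all add: pd_add distrib_right)

lemma pd_Const [simp]: "pd v (Const c) = 0"
  by (intro poly_mapping_eqI)
    (auto simp: lookup_pd Const_def lookup_single when_def poly_mapping_eq_iff fun_eq_iff
      lookup_add dest: spec[of _ v])

lemma pd_1 [simp]: "pd v 1 = 0"
  using pd_Const[of v 1] by simp

lemma pd_Var: "pd v (Var w) = (if v = w then 1 else (0 :: 'a::comm_ring_1 mpoly))"
  by (simp add: Var_def pd_single lookup_single)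

lemma pd_Const_mult [simp]: "pd v (Const c * p) = Const c * pd v p"
  by (simp add: pd_mult)

lemma pd_power: "pd v (p ^ k) = of_nat k * p ^ (k - 1) * pd v p"
proof (induction k)
  case (Suc k)
  then show ?case by (cases k) (simp_all add: pd_mult algebra_simps)
qed simp

lemma pd_prod:
  assumes "finite A"
  shows "pd v (\<Prod>i\<in>A. f i) = (\<Sum>i\<in>A. pd v (f i) * (\<Prod>j\<in>A - {i}. f j))"
  using assms
proof (induction A)
  case (insert a A)
  have "(\<Prod>j\<in>insert a A - {i}. f j) = f a * (\<Prod>j\<in>A - {i}. f j)" if "i \<in> A" for i
  proof -
    have "insert a A - {i} = insert a (A - {i})" using insert that by auto
    then show ?thesis using insert by simp
  qed
  then have "(\<Sum>i\<in>A. pd v (f i) * (\<Prod>j\<in>insert a A - {i}. f j))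
      = f a * (\<Sum>i\<in>A. pd v (f i) * (\<Prod>j\<in>A - {i}. f j))"
    by (simp add: sum_distrib_left mult_ac)
  moreover have "insert a A - {a} = A" using insert by auto
  ultimately show ?case using insert by (simp add: pd_mult)
qed simp

lemma pd_of_int [simp]: "pd v (of_int k) = 0"
  by (metis Const.hom_of_int pd_Const)

lemma pd_commute: "pd v (pd w p) = pd w (pd v p)"
proof (cases "v = w")
  case False
  then show ?thesis
    by (intro poly_mapping_eqI) (simp add: lookup_pd lookup_add lookup_single add_ac mult_ac)
qed simp

lemma vars_pd: "vars (pd v p) \<subseteq> vars p"
proof
  fix u assume "u \<in> vars (pd v p)"
  then obtain m where m: "m \<in> keys (pd v p)" "u \<in> keys m" by (auto simp: vars_def)
  then have "m + single v 1 \<in> keys p" "u \<in> keys (m + single v 1)"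
    by (auto simp: in_keys_iff lookup_pd lookup_add)
  then show "u \<in> vars p" by (auto simp: vars_def)
qed

lemma pd_eq_0: "v \<notin> vars p \<Longrightarrow> pd v p = 0"
proof (intro poly_mapping_eqI)
  fix m :: "nat \<Rightarrow>\<^sub>0 nat" assume "v \<notin> vars p"
  moreover have "v \<in> keys (m + single v 1)" by (simp add: in_keys_iff lookup_add)
  ultimately have "m + single v 1 \<notin> keys p" by (auto simp: vars_def)
  then show "lookup (pd v p) m = lookup 0 m" by (simp add: lookup_pd in_keys_iff)
qed

text \<open>Chain rule: both sides are additive and satisfy the same product rule along
  \<open>subst s\<close>, so agreement on constants and variables suffices.\<close>

lemma pd_subst:
  assumes "vars p \<subseteq> V" "finite V"
  shows "pd v (subst s p) = (\<Sum>w\<in>V. subst s (pd w p) * pd v (s w))"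
  using assms(1)
proof (induction p rule: mpoly_induct)
  case (Var u)
  then show ?case using \<open>finite V\<close>
    by (simp add: pd_Var if_distrib if_distribR sum.If_cases cong: if_cong)
next
  case (add p q)
  then show ?case by (simp add: subst.hom_add pd_add distrib_right sum.distrib)
next
  case (mult p q)
  then show ?case
    by (simp add: subst.hom_mult subst.hom_add pd_mult distrib_left distrib_right sum.distrib
        sum_distrib_left sum_distrib_right mult_ac)
qed simp

text \<open>A nonconstant monomial contains some variable \<open>v\<close>, and \<open>pd v\<close>
  multiplies its coefficient by a positive integer. In characteristic zero this integer is nonzero,
  so the coefficient must vanish.\<close>

lemma const_if_pd_eq_0:
  fixes p :: "'a::{idom,ring_char_0} mpoly"
  assumes "\<And>j. pd j p = 0"
  shows "p = Const (lookup p 0)"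
proof (rule poly_mapping_eqI)
  fix m
  show "lookup p m = lookup (Const (lookup p 0)) m"
  proof (cases "m = 0")
    case False
    then obtain v where v: "lookup m v \<noteq> 0" by (metis poly_mapping_eqI lookup_zero)
    define n where "n = m - single v 1"
    have "lookup (n + single v 1) u = lookup m u" for u
      using v by (cases "u = v") (simp_all add: n_def lookup_add lookup_minus lookup_single)
    then have m: "m = n + single v 1" by (metis poly_mapping_eqI)
    have "lookup (pd v p) n = 0" by (simp add: assms)
    then have "lookup p m = 0" by (simp add: lookup_pd m del: of_nat_Suc)
    with False show ?thesis by (simp add: Const_def lookup_single)
  qed (simp add: Const_def)
qed

subsection \<open>Homogeneous parts\<close>

text \<open>This is \<open>p(t x)\<close> as a polynomial in \<open>t\<close>. Its coefficients are
  the homogeneous parts of \<open>p\<close> and its degree is the total degree, so degree arguments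
  for products reduce to univariate polynomials over a domain.\<close>

definition tpoly :: "'a::comm_ring_1 mpoly \<Rightarrow> 'a mpoly poly" where
  "tpoly = ev (\<lambda>c. [:Const c:]) (\<lambda>v. monom (Var v) 1)"

lemma const_poly_hom: "comm_ring_hom (\<lambda>c. [:Const c:])"
  by unfold_locales (simp_all add: Const.hom_add Const.hom_mult one_pCons)

interpretation const_poly: comm_ring_hom "\<lambda>c. [:Const c:]"
  by (rule const_poly_hom)

interpretation tpoly: comm_ring_hom tpoly
  unfolding tpoly_def by (rule const_poly.ev_hom)

lemma tpoly_Const [simp]: "tpoly (Const c) = [:Const c:]"
  and tpoly_Var [simp]: "tpoly (Var v) = monom (Var v) 1"
  by (simp_all add: tpoly_def)

lemma mval_monom_Var: "mval (\<lambda>v. monom (Var v) 1) m = monom (mval Var m) (tdeg m)"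
proof -
  have "(\<Prod>v\<in>A. monom (Var v) 1 ^ f v) = monom (\<Prod>v\<in>A. Var v ^ f v) (sum f A)"
    if "finite A" for A and f :: "nat \<Rightarrow> nat"
    using that by (induction A) (simp_all add: monom_power mult_monom one_pCons monom_0)
  from this[of "keys m" "lookup m"] show ?thesis by (simp add: mval_def tdeg_def)
qed

lemma lookup_homog_part: "lookup (homog_part d p) m = (if tdeg m = d then lookup p m else 0)"
proof -
  have "lookup (homog_part d p) m
      = (\<Sum>k\<in>{k\<in>keys p. tdeg k = d}. if k = m then lookup p k else 0)"
    by (simp add: homog_part_def lookup_sum lookup_single when_def)
  also have "\<dots> = (if tdeg m = d then lookup p m else 0)"
    by (simp add: in_keys_iff)
  finally show ?thesis .
qed

lemma homog_part_add: "homog_part d (p + q) = homog_part d p + homog_part d q"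
  by (intro poly_mapping_eqI) (simp add: lookup_homog_part lookup_add)

lemma homog_part_0 [simp]: "homog_part d 0 = 0"
  by (simp add: homog_part_def)

lemma coeff_tpoly: "coeff (tpoly p) d = homog_part d p"
proof (induction p rule: mpoly_additive_induct)
  case (single m c)
  have "tpoly (single m c) = monom (single m c) (tdeg m)"
    unfolding tpoly_def ev_single[of "\<lambda>c. [:Const c:]", OF const_poly.hom_zero] mval_monom_Var
    by (simp add: smult_monom flip: single_conv_mval)
  then have "coeff (tpoly (single m c)) d = (if tdeg m = d then single m c else 0)"
    by simp
  also have "\<dots> = homog_part d (single m c)"
    by (intro poly_mapping_eqI) (auto simp: lookup_homog_part lookup_single when_def)
  finally show ?case .
qed (simp_all add: tpoly.hom_add homog_part_add)

lemma poly_tpoly_1: "poly (tpoly p) 1 = p"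
proof -
  have "poly (tpoly p) 1 = p" if "vars p \<subseteq> UNIV"
    using that by (induction p rule: mpoly_induct)
      (simp_all add: tpoly.hom_add tpoly.hom_mult poly_monom)
  then show ?thesis by simp
qed

lemma tpoly_eq_0_iff [simp]: "tpoly p = 0 \<longleftrightarrow> p = 0"
  by (metis poly_tpoly_1 poly_0 tpoly.hom_zero)

lemma tdeg_add: "tdeg (a + b) = tdeg a + tdeg b"
proof -
  have sup: "tdeg m = (\<Sum>v\<in>V. lookup m v)" if "finite V" "keys m \<subseteq> V" for m V
    unfolding tdeg_def using that by (intro sum.mono_neutral_left) (auto simp: in_keys_iff)
  let ?V = "keys a \<union> keys b"
  have "keys (a + b) \<subseteq> ?V" by (rule keys_add)
  then show ?thesis by (simp add: sup[of ?V] lookup_add sum.distrib)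
qed

lemma tdeg_eq_0_iff: "tdeg m = 0 \<longleftrightarrow> m = 0"
proof
  assume "tdeg m = 0"
  then have "lookup m k = 0" for k by (cases "k \<in> keys m") (auto simp: tdeg_def in_keys_iff)
  then show "m = 0" by (intro poly_mapping_eqI) simp
qed (simp add: tdeg_def)

lemma homog_part_pd: "homog_part d (pd v p) = pd v (homog_part (Suc d) p)"
proof -
  have "tdeg (single v 1) = 1" by (simp add: tdeg_def)
  then show ?thesis
    by (intro poly_mapping_eqI) (simp add: lookup_homog_part lookup_pd tdeg_add)
qed

lemma homog_part_0_eq: "homog_part 0 p = Const (lookup p 0)"
  by (intro poly_mapping_eqI)
    (auto simp: lookup_homog_part Const_def lookup_single when_def tdeg_eq_0_iff)

lemma homogeneous_imp_tpoly: "homogeneous d p \<Longrightarrow> tpoly p = monom p d"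
  by (intro poly_eqI poly_mapping_eqI)
    (auto simp: coeff_tpoly lookup_homog_part homogeneous_def in_keys_iff)

lemma tpoly_homog_part: "tpoly (homog_part d p) = monom (homog_part d p) d"
  by (rule homogeneous_imp_tpoly) (auto simp: homogeneous_def in_keys_iff lookup_homog_part split: if_splits)

section \<open>Total degree and units\<close>

lemma degree_tpoly_eq_0_iff: "degree (tpoly p) = 0 \<longleftrightarrow> p = Const (lookup p 0)"
proof
  assume "degree (tpoly p) = 0"
  then obtain a where a: "tpoly p = [:a:]" by (metis degree_eq_zeroE)
  then have "a = homog_part 0 p" by (metis coeff_pCons_0 coeff_tpoly)
  moreover have "p = a" using a poly_tpoly_1[of p] by simp
  ultimately show "p = Const (lookup p 0)" by (simp add: homog_part_0_eq)
next
  assume "p = Const (lookup p 0)"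
  then show "degree (tpoly p) = 0" by (metis degree_pCons_0 tpoly_Const)
qed

lemma degree_tpoly_mult:
  fixes p q :: "'a::idom mpoly"
  shows "p \<noteq> 0 \<Longrightarrow> q \<noteq> 0 \<Longrightarrow> degree (tpoly (p * q)) = degree (tpoly p) + degree (tpoly q)"
  by (simp add: tpoly.hom_mult degree_mult_eq)

lemma dvd_1_iff_Const:
  fixes p :: "'a::field mpoly"
  shows "p dvd 1 \<longleftrightarrow> (\<exists>c. c \<noteq> 0 \<and> p = Const c)"
proof
  assume "p dvd 1"
  then obtain q where q: "1 = p * q" by (elim dvdE)
  then have "p \<noteq> 0" "q \<noteq> 0" by auto
  then have "degree (tpoly (p * q)) = degree (tpoly p) + degree (tpoly q)"
    by (rule degree_tpoly_mult)
  then have "degree (tpoly p) = 0" by (simp flip: q)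
  with \<open>p \<noteq> 0\<close> show "\<exists>c. c \<noteq> 0 \<and> p = Const c"
    by (metis Const.hom_zero degree_tpoly_eq_0_iff)
next
  assume "\<exists>c. c \<noteq> 0 \<and> p = Const c"
  then show "p dvd 1" by (metis Const_inverse dvdI)
qed

lemma dvd_1_iff_degree:
  fixes p :: "'a::field mpoly"
  shows "p \<noteq> 0 \<Longrightarrow> p dvd 1 \<longleftrightarrow> degree (tpoly p) = 0"
  by (metis Const.hom_zero dvd_1_iff_Const degree_tpoly_eq_0_iff Const_def lookup_single_eq)

subsection \<open>Jacobian matrices\<close>

definition jac_mat :: "nat \<Rightarrow> (nat \<Rightarrow> 'a::comm_ring_1 mpoly) \<Rightarrow> 'a mpoly mat" where
  "jac_mat n G = mat n n (\<lambda>(i, j). pd j (G i))"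

lemma jac_mat_carrier [simp]: "jac_mat n G \<in> carrier_mat n n"
  by (simp add: jac_mat_def)

lemma det_jac_mat: "det (jac_mat n G) = jac_det n G"
proof -
  have "(\<Prod>i = 0..<n. jac_mat n G $$ (i, \<pi> i)) = (\<Prod>i<n. pd (\<pi> i) (G i))"
    if "\<pi> permutes {..<n}" for \<pi>
    unfolding atLeast0LessThan using permutes_in_image[OF that]
    by (intro prod.cong) (auto simp: jac_mat_def)
  then show ?thesis
    unfolding det_def'[OF jac_mat_carrier] jac_det_def atLeast0LessThan
    by (intro sum.cong) simp_all
qed

text \<open>Jacobi's formula. The product rule turns the derivative of the determinant into a sum
  over the rows being differentiated, and each summand is expanded by Laplace along that
  row.\<close>

lemma pd_det:
  fixes A :: "'a::comm_ring_1 mpoly mat"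
  assumes A: "A \<in> carrier_mat n n"
  shows "pd v (det A) = (\<Sum>i<n. \<Sum>j<n. pd v (A $$ (i, j)) * cofactor A i j)"
proof -
  \<comment> \<open>\<open>B i\<close> is \<open>A\<close> with row \<open>i\<close> differentiated;
    deleting row \<open>i\<close> therefore leaves the cofactors of \<open>A\<close>.\<close>
  define B where "B i = mat n n (\<lambda>(k, l). if k = i then pd v (A $$ (k, l)) else A $$ (k, l))" for i
  have B: "B i \<in> carrier_mat n n" for i by (simp add: B_def)
  have prod: "(\<Prod>k\<in>{0..<n}. B i $$ (k, \<pi> k))
      = pd v (A $$ (i, \<pi> i)) * (\<Prod>k\<in>{0..<n} - {i}. A $$ (k, \<pi> k))"
    if "i < n" "\<pi> permutes {0..<n}" for i \<pi>
  proof -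
    have \<pi>: "\<pi> k < n" if "k < n" for k
      using permutes_in_image[OF \<open>\<pi> permutes {0..<n}\<close>, of k] that by simp
    have "(\<Prod>k\<in>{0..<n} - {i}. B i $$ (k, \<pi> k)) = (\<Prod>k\<in>{0..<n} - {i}. A $$ (k, \<pi> k))"
      by (intro prod.cong) (auto simp: B_def \<pi>)
    then show ?thesis
      using \<open>i < n\<close> by (simp add: prod.remove[of _ i] B_def \<pi>)
  qed
  have "pd v (det A) = (\<Sum>\<pi> | \<pi> permutes {0..<n}.
      of_int (sign \<pi>) * (\<Sum>i<n. \<Prod>k\<in>{0..<n}. B i $$ (k, \<pi> k)))"
    unfolding det_def'[OF A] pd_sum
    by (intro sum.cong refl) (simp add: pd_mult pd_prod prod flip: atLeast0LessThan)
  also have "\<dots> = (\<Sum>i<n. det (B i))"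
    unfolding det_def'[OF B] sum_distrib_left by (subst sum.swap) simp
  also have "det (B i) = (\<Sum>j<n. pd v (A $$ (i, j)) * cofactor A i j)" if "i < n" for i
  proof -
    have "mat_delete (B i) i j = mat_delete A i j" if "j < n" for j
      using A by (intro eq_matI) (auto simp: mat_delete_def B_def)
    then show ?thesis
      using that unfolding laplace_expansion_row[OF B that]
      by (intro sum.cong refl) (simp add: cofactor_def B_def)
  qed
  then have "(\<Sum>i<n. det (B i)) = (\<Sum>i<n. \<Sum>j<n. pd v (A $$ (i, j)) * cofactor A i j)"
    by simp
  finally show ?thesis .
qed

lemma adj_mat_mult_entry:
  assumes "A \<in> carrier_mat n n" "i < n" "j < n"
  shows "(\<Sum>k<n. A $$ (i, k) * adj_mat A $$ (k, j)) = (if i = j then det A else 0)"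
    and "(\<Sum>k<n. adj_mat A $$ (i, k) * A $$ (k, j)) = (if i = j then det A else 0)"
proof -
  note a = adj_mat[OF assms(1)]
  have "(A * adj_mat A) $$ (i, j) = (\<Sum>k<n. A $$ (i, k) * adj_mat A $$ (k, j))"
    using assms a(1) by (simp add: scalar_prod_def atLeast0LessThan)
  then show "(\<Sum>k<n. A $$ (i, k) * adj_mat A $$ (k, j)) = (if i = j then det A else 0)"
    using assms by (cases "i = j") (simp_all add: a(2))
  have "(adj_mat A * A) $$ (i, j) = (\<Sum>k<n. adj_mat A $$ (i, k) * A $$ (k, j))"
    using assms a(1) by (simp add: scalar_prod_def atLeast0LessThan)
  then show "(\<Sum>k<n. adj_mat A $$ (i, k) * A $$ (k, j)) = (if i = j then det A else 0)"
    using assms by (cases "i = j") (simp_all add: a(3))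
qed

text \<open>The second equation is Jacobi's formula for the vanishing derivative of the Jacobian
  determinant; by symmetry of the Jacobian, only the component \<open>G i\<close> enters.\<close>

lemma keller_symmetric_equations:
  assumes "keller n G" "jac_symmetric n G" "i < n"
  shows "\<exists>W c. c \<noteq> 0 \<and>
    (\<forall>j<n. (\<Sum>k<n. pd k (G i) * W k j) = (if i = j then Const c else 0)) \<and>
    (\<Sum>j<n. \<Sum>k<n. pd j (pd k (G i)) * W k j) = 0"
proof -
  from assms(1) obtain c where c: "c \<noteq> 0" "jac_det n G = Const c" by (auto simp: keller_def)
  define J where "J = jac_mat n G"
  have J: "J \<in> carrier_mat n n" "det J = Const c" by (simp_all add: J_def det_jac_mat c)
  have e: "J $$ (j, k) = pd k (G j)" if "j < n" "k < n" for j k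
    using that by (simp add: J_def jac_mat_def)
  show ?thesis
  proof (intro exI[of _ "\<lambda>k j. adj_mat J $$ (k, j)"] exI[of _ c] conjI allI impI)
    show "c \<noteq> 0" by fact
    show "(\<Sum>k<n. pd k (G i) * adj_mat J $$ (k, j)) = (if i = j then Const c else 0)" if "j < n" for j
      using adj_mat_mult_entry(1)[OF J(1) assms(3) that] assms(3) J(2) by (simp add: e)
    have "pd j (pd k (G i)) = pd i (pd k (G j))" if "j < n" "k < n" for j k
      using assms(2,3) that by (metis jac_symmetric_def pd_commute)
    moreover have "adj_mat J $$ (k, j) = cofactor J j k" if "j < n" "k < n" for j k
      using that J(1) by (simp add: adj_mat_def)
    ultimately have "(\<Sum>j<n. \<Sum>k<n. pd j (pd k (G i)) * adj_mat J $$ (k, j)) = pd i (det J)"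
      unfolding pd_det[OF J(1)] by (intro sum.cong refl) (simp add: e)
    then show "(\<Sum>j<n. \<Sum>k<n. pd j (pd k (G i)) * adj_mat J $$ (k, j)) = 0"
      by (simp add: J(2))
  qed
qed

subsection \<open>Affine factors of components\<close>

lemma dvd_Const_mult_cancel:
  fixes p :: "'a::field mpoly"
  assumes "p dvd Const c * q" "c \<noteq> 0"
  shows "p dvd q"
proof -
  have "Const (inverse c) * (Const c * q) = Const c * Const (inverse c) * q"
    by (simp only: mult_ac)
  also have "\<dots> = q" by (simp only: Const_inverse[OF assms(2)] mult_1)
  finally show ?thesis using dvd_mult[OF assms(1), of "Const (inverse c)"] by metis
qed

text \<open>Subtracting the linear form leaves a polynomial with all derivatives zero, hence a
  constant. \<open>V\<close> may exceed \<open>vars A\<close>, so that callers can include the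
  particular indices at which they substitute.\<close>

lemma affine_expansion:
  fixes A :: "'a::{idom,ring_char_0} mpoly"
  assumes "\<And>j. pd j A = Const (a j)" "vars A \<subseteq> V" "finite V"
  obtains e where "A = Const e + (\<Sum>j\<in>V. Const (a j) * Var j)"
proof -
  have a: "a j = 0" if "j \<notin> V" for j
    using assms(1)[of j] pd_eq_0[of j A] that assms(2) by auto
  define B where "B = A - (\<Sum>j\<in>V. Const (a j) * Var j)"
  have "pd k (\<Sum>j\<in>V. Const (a j) * Var j) = Const (a k)" for k
    using assms(3) a[of k] by (simp add: pd_sum pd_Var if_distrib sum.If_cases cong: if_cong)
  then have "B = Const (lookup B 0)"
    by (intro const_if_pd_eq_0) (simp add: B_def pd_diff assms(1))
  then have "A = Const (lookup B 0) + (\<Sum>j\<in>V. Const (a j) * Var j)"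
    by (simp add: B_def algebra_simps)
  then show ?thesis by (rule that)
qed

text \<open>Projection onto the zero set of \<open>A\<close> along the \<open>i\<close>-th axis.\<close>

lemma affine_projection:
  fixes A :: "'a::field_char_0 mpoly"
  assumes "\<And>j. pd j A = Const (a j)" "a i \<noteq> 0"
  obtains s where "subst s A = 0" "\<And>p. A dvd p - subst s p"
proof
  \<comment> \<open>\<open>A\<close> is affine with coefficient \<open>a i\<close> at
    \<open>Var i\<close>, so replacing \<open>Var i\<close> by \<open>Var i - A / a i\<close>
    subtracts \<open>A\<close> from itself.\<close>
  define s where "s v = (if v = i then Var i - Const (inverse (a i)) * A else Var v)" for v
  let ?V = "insert i (vars A)"
  obtain e where e: "A = Const e + (\<Sum>j\<in>?V. Const (a j) * Var j)"
    by (rule affine_expansion[of A a ?V]) (use assms in auto)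
  have "subst s A = Const e + (\<Sum>j\<in>?V. Const (a j) * s j)"
    by (subst e) (simp only: subst.hom_add subst.hom_sum subst.hom_mult subst_Const subst_Var)
  also have "(\<Sum>j\<in>?V. Const (a j) * s j) =
      (\<Sum>j\<in>?V. Const (a j) * Var j) - (\<Sum>j\<in>?V. if j = i then A else 0)"
    unfolding sum_subtractf[symmetric]
    by (intro sum.cong refl)
      (use Const_inverse[OF assms(2)] in \<open>auto simp: s_def right_diff_distrib mult.assoc[symmetric]\<close>)
  also have "Const e + \<dots> = (Const e + (\<Sum>j\<in>?V. Const (a j) * Var j)) - A" by simp
  also have "\<dots> = 0" by (simp flip: e)
  finally show "subst s A = 0" .
  show "A dvd p - subst s p" for p
  proof -
    have "A dvd p - subst s p" if "vars p \<subseteq> UNIV"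
      using that
    proof (induction p rule: mpoly_induct)
      case (Var v)
      have "Var i - s i = A * Const (inverse (a i))" by (simp add: s_def)
      then show ?case by (cases "v = i") (simp_all add: s_def[of v])
    next
      case (add p q)
      have "p + q - subst s (p + q) = (p - subst s p) + (q - subst s q)"
        by (simp add: subst.hom_add)
      with add show ?case by (metis dvd_add)
    next
      case (mult p q)
      have "p * q - subst s (p * q) = (p - subst s p) * q + subst s p * (q - subst s q)"
        by (simp add: subst.hom_mult algebra_simps)
      with mult show ?case by (metis dvd_add dvd_mult dvd_mult2)
    qed simp
    then show ?thesis by simp
  qed
qed

text \<open>Writing the cofactor as \<open>u\<^sub>0 + A\<^sup>k N\<close>, the leading term of Jacobi's equation along \<open>A = 0\<close>
  forces \<open>A\<close> to divide \<open>N\<close>, so the cofactor agrees with \<open>u\<^sub>0\<close> to any order.\<close>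

lemma affine_factor_cofactor_const:
  fixes G :: "nat \<Rightarrow> 'a::field_char_0 mpoly"
  assumes keller: "keller n G" "jac_symmetric n G" "i < n"
    and A: "\<And>j. pd j A = Const (a j)" "a i \<noteq> 0"
    and fac: "G i + Const c0 = A * U"
  shows "\<exists>u0. U = Const u0"
proof -
  obtain W and c :: 'a where c: "c \<noteq> 0"
    and F1: "\<And>j. j < n \<Longrightarrow> (\<Sum>k<n. pd k (G i) * W k j) = (if i = j then Const c else 0)"
    and F2: "(\<Sum>j<n. \<Sum>k<n. pd j (pd k (G i)) * W k j) = 0"
    using keller_symmetric_equations[OF keller] by blast
  have "G i = A * U - Const c0" by (simp flip: fac)
  then have G: "pd k (G i) = pd k (A * U)" for k by (simp add: pd_diff)
  \<comment> \<open>\<open>s\<close> is the quadratic form of \<open>W\<close> on the gradient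
    \<open>a\<close> of \<open>A\<close>. Contracting the first-order equations with
    \<open>a\<close> will give \<open>U * s + A * t = Const (a i * c)\<close>, so both
    \<open>U\<close> and \<open>s\<close> are invertible modulo \<open>A\<close>.\<close>
  define s where "s = (\<Sum>j<n. \<Sum>k<n. Const (a j * a k) * W k j)"
  define t where "t = (\<Sum>j<n. \<Sum>k<n. Const (a j) * pd k U * W k j)"
  have "(\<Sum>j<n. Const (a j) * (\<Sum>k<n. pd k (G i) * W k j)) = Const (a i * c)"
    using keller(3) by (simp add: F1 if_distrib Const.hom_mult cong: if_cong)
  moreover have "(\<Sum>j<n. Const (a j) * (\<Sum>k<n. pd k (G i) * W k j)) = U * s + A * t"
    unfolding s_def t_def G pd_mult A Const.hom_mult sum_distrib_left sum.distrib[symmetric]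
    by (intro sum.cong refl) (simp only: algebra_simps)
  ultimately have st: "U * s + A * t = Const (a i * c)" by simp
  have ac: "a i * c \<noteq> 0" using c A(2) by simp
  obtain \<rho> where \<rho>: "subst \<rho> A = 0" "\<And>p. A dvd p - subst \<rho> p"
    by (rule affine_projection[of A a i]) (use A in auto)
  \<comment> \<open>On \<open>A = 0\<close> the term with \<open>t\<close> drops out, so the
    restriction of \<open>U\<close> is a unit of the polynomial ring and hence a constant
    \<open>u0\<close>.\<close>
  from arg_cong[OF st, of "subst \<rho>"] have "subst \<rho> U * subst \<rho> s = Const (a i * c)"
    by (simp add: subst.hom_add subst.hom_mult \<rho>(1))
  then have "subst \<rho> U * (subst \<rho> s * Const (inverse (a i * c))) = 1"
    using Const_inverse[OF ac] by (simp add: mult.assoc[symmetric])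
  then have "subst \<rho> U dvd 1" by (metis dvdI)
  then obtain u0 where u0: "subst \<rho> U = Const u0" by (auto simp: dvd_1_iff_Const)
  have A0: "A \<noteq> 0" using A(2) A(1)[of i] by auto
  have pow: "A ^ Suc k dvd U - Const u0" for k
  proof (induction k)
    case 0
    show ?case using \<rho>(2)[of U] u0 by simp
  next
    case (Suc k)
    then obtain N where N: "U - Const u0 = A ^ Suc k * N" unfolding dvd_def by blast
    let ?m = "Suc (Suc k)"
    \<comment> \<open>\<open>A * R p q\<close> collects the Hessian terms of
      \<open>A ^ ?m * N\<close> that are divisible by \<open>A ^ Suc k\<close>, after
      \<open>A ^ k\<close> is taken out.\<close>
    define R where "R p q = of_nat ?m * (Const (a q) * pd p N + Const (a p) * pd q N)
      + A * pd p (pd q N)" for p q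
    have "U = Const u0 + A ^ Suc k * N" by (metis N add.commute diff_add_cancel)
    then have AU: "A * U = Const u0 * A + A ^ ?m * N"
      by (simp add: distrib_left mult.commute mult.left_commute)
    \<comment> \<open>\<open>Const u0 * A\<close> is affine and contributes nothing to the second
      derivatives; the lowest power of \<open>A\<close> comes from differentiating
      \<open>A ^ ?m\<close> twice.\<close>
    have hess: "pd p (pd q (A * U)) = A ^ k * (of_nat (?m * Suc k) * (Const (a p * a q) * N)
        + A * R p q)" for p q
    proof -
      have P: "pd p (A ^ Suc k) = of_nat (Suc k) * A ^ k * Const (a p)" for p k
        unfolding pd_power A by (simp del: of_nat_Suc)
      have O: "pd p (of_nat l * q) = of_nat l * pd p q" for p q l
        by (metis Const.hom_of_nat pd_Const_mult)
      have D: "pd q (A * U) = Const u0 * Const (a q)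
          + of_nat ?m * (A ^ Suc k * (Const (a q) * N)) + A ^ ?m * pd q N"
        unfolding AU pd_add pd_mult P A
        by (simp only: pd_Const mult_zero_right mult_zero_left add_0_left add_0_right)
          (simp only: algebra_simps)
      have "pd p (pd q (A * U)) = of_nat ?m * (of_nat (Suc k) * A ^ k * Const (a p) * (Const (a q) * N)
          + A ^ Suc k * (Const (a q) * pd p N))
          + (of_nat ?m * A ^ Suc k * Const (a p) * pd q N + A ^ ?m * pd p (pd q N))"
        unfolding D pd_add O pd_mult[of p "A ^ _"] P by simp
      also have "\<dots> = A ^ k * (of_nat (?m * Suc k) * (Const (a p * a q) * N) + A * R p q)"
        unfolding R_def of_nat_mult Const.hom_mult power_Suc by (simp only: algebra_simps)
      finally show ?thesis .
    qed
    have "(\<Sum>j<n. \<Sum>l<n. pd j (pd l (G i)) * W l j) = (\<Sum>j<n. \<Sum>l<n. A ^ k *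
        (of_nat (?m * Suc k) * N * (Const (a j * a l) * W l j) + A * (R j l * W l j)))"
      by (intro sum.cong refl) (simp only: G hess algebra_simps)
    also have "\<dots> = A ^ k * (of_nat (?m * Suc k) * N * s + A * (\<Sum>j<n. \<Sum>l<n. R j l * W l j))"
      by (simp only: s_def sum_distrib_left sum.distrib distrib_left)
    finally have "A ^ k * (of_nat (?m * Suc k) * N * s + A * (\<Sum>j<n. \<Sum>l<n. R j l * W l j)) = 0"
      by (simp only: F2)
    then have "of_nat (?m * Suc k) * N * s + A * (\<Sum>j<n. \<Sum>l<n. R j l * W l j) = 0"
      using A0 by (simp only: mult_eq_0_iff power_eq_0_iff) simp
    then have "of_nat (?m * Suc k) * N * s = A * - (\<Sum>j<n. \<Sum>l<n. R j l * W l j)"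
      by (simp only: add_eq_0_iff2 mult_minus_right)
    then have "A dvd Const (of_nat (?m * Suc k)) * (N * s)"
      by (simp only: Const.hom_of_nat mult.assoc dvd_triv_left)
    \<comment> \<open>The integer \<open>?m * Suc k\<close> is a nonzero constant in characteristic
      zero.\<close>
    then have "A dvd N * s"
      by (rule dvd_Const_mult_cancel) (simp del: of_nat_Suc of_nat_mult)
    \<comment> \<open>Multiplying by \<open>U\<close>, which inverts \<open>s\<close> modulo
      \<open>A\<close> up to a nonzero constant, removes \<open>s\<close>.\<close>
    then have "A dvd U * (N * s) + A * (t * N)" by (meson dvd_add dvd_mult dvd_triv_left)
    also have "U * (N * s) + A * (t * N) = (U * s + A * t) * N"
      by (simp only: algebra_simps)
    finally have "A dvd Const (a i * c) * N" unfolding st .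
    then have "A dvd N" using ac by (rule dvd_Const_mult_cancel)
    then have "A ^ Suc k * A dvd A ^ Suc k * N" by (rule mult_dvd_mono[OF dvd_refl])
    then show ?case unfolding N by (simp only: power_Suc2)
  qed
  have "U - Const u0 = 0"
  proof (rule ccontr)
    assume nz: "U - Const u0 \<noteq> 0"
    \<comment> \<open>A nonzero difference of degree \<open>d\<close> cannot be divisible by
      \<open>A ^ Suc d\<close>, as \<open>A\<close> is nonconstant.\<close>
    define d where "d = degree (tpoly (U - Const u0))"
    obtain N where N: "U - Const u0 = A ^ Suc d * N" using pow[of d] unfolding dvd_def by blast
    then have "N \<noteq> 0" using nz by auto
    have "degree (tpoly A) \<noteq> 0"
    proof
      assume "degree (tpoly A) = 0"
      then have "pd i A = pd i (Const (lookup A 0))" by (simp only: degree_tpoly_eq_0_iff)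
      then show False using A by simp
    qed
    then have "d < Suc d * degree (tpoly A)" by (cases "degree (tpoly A)") simp_all
    then have "d < degree (tpoly (A ^ Suc d))"
      using A0 by (simp add: tpoly.hom_power degree_power_eq del: power_Suc)
    also have "\<dots> \<le> degree (tpoly (A ^ Suc d * N))"
      using degree_tpoly_mult[of "A ^ Suc d" N] A0 \<open>N \<noteq> 0\<close> by simp
    also have "\<dots> = d" by (simp only: N[symmetric] d_def[symmetric])
    finally show False by simp
  qed
  then show ?thesis by auto
qed

subsection \<open>Components with homogeneous nonlinear part\<close>

lemma affine_pd_const:
  assumes "degree (tpoly p) \<le> 1"
  shows "\<exists>a. \<forall>j. pd j p = Const (a j)"
proof (intro exI allI)
  fix j
  have "coeff (tpoly (pd j p)) d = 0" if "d > 0" for d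
  proof -
    have "coeff (tpoly p) (Suc d) = 0" using that assms by (intro coeff_eq_0) simp
    then show ?thesis by (simp add: coeff_tpoly homog_part_pd)
  qed
  then have "degree (tpoly (pd j p)) = 0"
    by (metis leading_coeff_0_iff degree_0 neq0_conv)
  then show "pd j p = Const (lookup (pd j p) 0)" by (simp only: degree_tpoly_eq_0_iff)
qed

lemma irreducible_if_degree_1:
  fixes p :: "'a::field mpoly"
  assumes "degree (tpoly p) = 1"
  shows "irreducible p"
proof (rule irreducibleI)
  show "p \<noteq> 0" using assms by auto
  then show "\<not> p dvd 1" using assms by (simp add: dvd_1_iff_degree)
  fix a b assume ab: "p = a * b"
  with \<open>p \<noteq> 0\<close> have nz: "a \<noteq> 0" "b \<noteq> 0" by auto
  then have "degree (tpoly a) + degree (tpoly b) = 1"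
    using assms degree_tpoly_mult[OF nz] by (simp only: ab)
  then have "degree (tpoly a) = 0 \<or> degree (tpoly b) = 0" by linarith
  then show "a dvd 1 \<or> b dvd 1" using nz by (simp add: dvd_1_iff_degree)
qed

text \<open>At a common zero of \<open>P\<close> and \<open>Q\<close> the product rule kills every
  derivative of \<open>G i\<close>. The diagonal first-order equation would then read
  \<open>0 = c\<close>.\<close>

lemma keller_component_no_singular_zero:
  fixes G :: "nat \<Rightarrow> 'a::field_char_0 mpoly"
  assumes "keller n G" "jac_symmetric n G" "i < n" "G i + Const c0 = P * Q"
  shows "\<not> (subst (\<lambda>v. Const (x v)) P = 0 \<and> subst (\<lambda>v. Const (x v)) Q = 0)"
proof
  assume z: "subst (\<lambda>v. Const (x v)) P = 0 \<and> subst (\<lambda>v. Const (x v)) Q = 0"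
  obtain W and c :: 'a where c: "c \<noteq> 0"
    and F1: "\<And>j. j < n \<Longrightarrow> (\<Sum>k<n. pd k (G i) * W k j) = (if i = j then Const c else 0)"
    using keller_symmetric_equations[OF assms(1-3)] by blast
  have "G i = P * Q - Const c0" by (simp flip: assms(4))
  then have "pd k (G i) = pd k (P * Q)" for k by (simp add: pd_diff)
  then have "subst (\<lambda>v. Const (x v)) (pd k (G i)) = 0" for k
    using z by (simp add: pd_mult subst.hom_add subst.hom_mult)
  then have "subst (\<lambda>v. Const (x v)) (\<Sum>k<n. pd k (G i) * W k i) = 0"
    by (simp add: subst.hom_sum subst.hom_mult)
  then show False using F1[OF assms(3)] c by simp
qed

text \<open>If the nonlinear part has degree at least 2, one of two factors has zero constant term.
  When the other factor is not a unit, comparing homogeneous parts shows that the linear part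
  \<open>L\<close> divides the first, and the result on affine factors makes the remaining cofactor
  constant.\<close>

lemma irreducible_linear_plus_homogeneous:
  fixes G :: "nat \<Rightarrow> 'a::field_char_0 mpoly"
  assumes keller: "keller n G" "jac_symmetric n G" "i < n"
    and lin: "pd i (homog_part 1 (G i)) \<noteq> 0"
    and hom: "homogeneous d (G i - homog_part 1 (G i))"
  shows "irreducible (G i)"
proof -
  define L where "L = homog_part 1 (G i)"
  define H where "H = G i - L"
  have "tpoly H = monom H d" using hom by (simp add: homogeneous_imp_tpoly H_def L_def)
  moreover have tL: "tpoly L = monom L 1" unfolding L_def by (rule tpoly_homog_part)
  moreover have "G i = L + H" by (simp add: H_def)
  ultimately have tG: "tpoly (G i) = monom L 1 + monom H d" by (simp add: tpoly.hom_add)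
  have L0: "L \<noteq> 0" using lin by (auto simp: L_def)
  have c1: "coeff (tpoly (G i)) 1 = L" by (simp add: coeff_tpoly L_def)
  then have G0: "degree (tpoly (G i)) \<ge> 1" using L0 le_degree[of "tpoly (G i)" 1] by simp
  show ?thesis
  proof (cases "d \<le> 1 \<or> H = 0")
    case True
    then have "degree (tpoly (G i)) \<le> 1"
      unfolding tG
      by (cases "H = 0") (auto intro!: degree_add_le degree_monom_le[THEN order_trans])
    with G0 show ?thesis by (intro irreducible_if_degree_1) simp
  next
    case False
    then have d: "d \<ge> 2" "H \<noteq> 0" by auto
    have cG: "coeff (tpoly (G i)) m = (if m = 1 then L else 0)" if "m < d" for m
      using that unfolding tG by auto
    have dG: "degree (tpoly (G i)) = d"
      using d unfolding tG by (subst degree_add_eq_right) (auto simp: degree_monom_eq L0)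
    have Gnz: "G i \<noteq> 0" using G0 by auto
    have L1: "degree (tpoly L) \<le> 1" unfolding tL by (rule degree_monom_le)
    obtain a where a: "pd j L = Const (a j)" for j using affine_pd_const[OF L1] by blast
    have ai: "a i \<noteq> 0" using lin a[of i] by (auto simp: L_def)
    have key: False if PQ: "G i = P * Q" and p0: "coeff (tpoly P) 0 = 0" and Q: "\<not> Q dvd 1" for P Q
    proof -
      have nz: "P \<noteq> 0" "Q \<noteq> 0" using Gnz PQ by auto
      have "degree (tpoly Q) \<noteq> 0" using Q nz by (simp add: dvd_1_iff_degree)
      then have dP: "degree (tpoly P) < d"
        using degree_tpoly_mult[OF nz] dG by (simp add: PQ)
      define e where "e = lookup Q 0"
      have q0: "coeff (tpoly Q) 0 = Const e" by (simp add: coeff_tpoly homog_part_0_eq e_def)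
      \<comment> \<open>Splitting off the last term of the convolution isolates the degree
        \<open>m\<close> part of \<open>P\<close>, multiplied by the constant term \<open>e\<close>
        of \<open>Q\<close>.\<close>
      have cPQ: "coeff (tpoly (G i)) m = (\<Sum>k<m. coeff (tpoly P) k * coeff (tpoly Q) (m - k))
          + coeff (tpoly P) m * Const e" for m
        unfolding PQ tpoly.hom_mult coeff_mult lessThan_Suc_atMost[symmetric] sum.lessThan_Suc
        by (simp only: diff_self_eq_0 q0)
      have "coeff (tpoly P) 1 * Const e = L" using cPQ[of 1] c1 p0 by simp
      then have e: "e \<noteq> 0" using L0 by auto
      \<comment> \<open>Below degree \<open>d\<close> the parts of \<open>G i\<close> are
        \<open>L\<close> or zero, and \<open>e\<close> is invertible; so divisibility by
        \<open>L\<close> passes from the lower parts of \<open>P\<close> to the next. As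
        \<open>P\<close> has degree below \<open>d\<close>, this covers all of
        \<open>P\<close>.\<close>
      have Ldvd: "L dvd coeff (tpoly P) m" if "m < d" for m
        using that
      proof (induction m rule: less_induct)
        case (less m)
        have "L dvd (\<Sum>k<m. coeff (tpoly P) k * coeff (tpoly Q) (m - k))"
          using less by (intro dvd_sum dvd_mult2) auto
        moreover have "L dvd coeff (tpoly (G i)) m" using cG[OF less.prems] by simp
        ultimately have "L dvd coeff (tpoly P) m * Const e"
          unfolding cPQ by (simp add: dvd_add_right_iff)
        then have "L dvd Const e * coeff (tpoly P) m" by (simp only: mult.commute)
        then show ?case using e by (rule dvd_Const_mult_cancel)
      qed
      have "L dvd poly (tpoly P) 1"
        unfolding poly_altdef using Ldvd dP by (intro dvd_sum) simp
      then obtain R where R: "P = L * R" unfolding poly_tpoly_1 dvd_def by blast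
      have "G i + Const 0 = L * (R * Q)" by (simp add: PQ R mult.assoc)
      then obtain u where u: "R * Q = Const u"
        using affine_factor_cofactor_const[OF keller a ai] by blast
      have "u \<noteq> 0" using u nz R by auto
      then have "R * Q dvd 1" unfolding u by (auto simp: dvd_1_iff_Const)
      then have "Q dvd 1" by (rule dvd_mult_right)
      with Q show False by simp
    qed
    show ?thesis
    proof (rule irreducibleI)
      show "G i \<noteq> 0" by fact
      show "\<not> G i dvd 1" using dG d Gnz by (simp add: dvd_1_iff_degree)
      fix P Q assume PQ: "G i = P * Q"
      have "coeff (tpoly (G i)) 0 = 0" using cG[of 0] d by simp
      then have "coeff (tpoly P) 0 = 0 \<or> coeff (tpoly Q) 0 = 0"
        by (simp add: PQ tpoly.hom_mult coeff_mult)
      moreover have "G i = Q * P" using PQ by (simp only: mult.commute)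
      ultimately show "P dvd 1 \<or> Q dvd 1" using key[OF PQ] key[of Q P] by blast
    qed
  qed
qed

text \<open>Points supported on the coordinates \<open>k\<close> and \<open>i\<close> give two free
  parameters, enough to solve two affine equations simultaneously when looking for a common
  zero.\<close>

lemma affine_eval:
  fixes A :: "'a::field_char_0 mpoly"
  assumes "\<And>j. pd j A = Const (a j)" "k \<noteq> i"
  shows "\<exists>e. \<forall>\<alpha> \<beta>. subst (\<lambda>v. Const (if v = k then \<alpha> else if v = i then \<beta> else 0)) A
    = Const (e + a k * \<alpha> + a i * \<beta>)"
proof -
  let ?V = "{i, k} \<union> vars A"
  obtain e where e: "A = Const e + (\<Sum>j\<in>?V. Const (a j) * Var j)"
    by (rule affine_expansion[of A a ?V]) (use assms in auto)
  have "subst (\<lambda>v. Const (x v)) A = Const (e + (\<Sum>j\<in>?V. a j * x j))" for x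
    by (subst e) (simp only: subst.hom_add subst.hom_sum subst.hom_mult subst_Const subst_Var
        Const.hom_add Const.hom_sum Const.hom_mult)
  moreover have "(\<Sum>j\<in>?V. a j * (if j = k then \<alpha> else if j = i then \<beta> else 0))
      = a k * \<alpha> + a i * \<beta>" for \<alpha> \<beta>
  proof -
    have "(\<Sum>j\<in>?V. a j * (if j = k then \<alpha> else if j = i then \<beta> else 0))
        = (\<Sum>j\<in>{k, i}. a j * (if j = k then \<alpha> else if j = i then \<beta> else 0))"
      by (intro sum.mono_neutral_right) auto
    then show ?thesis using assms(2) by simp
  qed
  ultimately show ?thesis by (intro exI[of _ e]) (simp add: add.assoc)
qed

text \<open>A proper factorisation of a cubic is an affine \<open>P\<close> times a quadratic
  \<open>Q\<close>. If \<open>P\<close> involves the variable \<open>i\<close>, the result on affine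
  factors applies; otherwise the missing quadratic part of the product forces a common zero of
  \<open>P\<close> and \<open>Q\<close>.\<close>

lemma irreducible_linear_plus_cubic:
  fixes G :: "nat \<Rightarrow> 'a::field_char_0 mpoly"
  assumes keller: "keller n G" "jac_symmetric n G" "i < n"
    and lin: "pd i (homog_part 1 (G i)) \<noteq> 0"
    and hom: "homogeneous 3 (G i - homog_part 1 (G i))"
  shows "irreducible (G i + Const c0)"
proof -
  define L where "L = homog_part 1 (G i)"
  define H where "H = G i - L"
  define g where "g = G i + Const c0"
  have "tpoly H = monom H 3" using hom by (simp add: homogeneous_imp_tpoly H_def L_def)
  moreover have tL: "tpoly L = monom L 1" unfolding L_def by (rule tpoly_homog_part)
  moreover have "g = L + H + Const c0" by (simp add: H_def g_def)
  ultimately have tG: "tpoly g = monom L 1 + monom H 3 + [:Const c0:]" by (simp add: tpoly.hom_add)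
  have L0: "L \<noteq> 0" using lin by (auto simp: L_def)
  have c1: "coeff (tpoly g) 1 = L" and c2: "coeff (tpoly g) 2 = 0" and c3: "coeff (tpoly g) 3 = H"
    by (simp_all add: tG numeral_2_eq_2 numeral_3_eq_3)
  have G0: "degree (tpoly g) \<ge> 1" using L0 c1 le_degree[of "tpoly g" 1] by simp
  have "irreducible g"
  proof (cases "H = 0")
    case True
    then have "degree (tpoly g) \<le> 1"
      unfolding tG True monom_eq_0 add_0_right
      by (intro degree_add_le degree_monom_le) simp
    with G0 show ?thesis by (intro irreducible_if_degree_1) simp
  next
    case False
    have dG: "degree (tpoly g) = 3"
    proof (rule antisym)
      show "degree (tpoly g) \<le> 3"
        unfolding tG by (intro degree_add_le degree_monom_le[THEN order_trans]) auto
      show "3 \<le> degree (tpoly g)" using c3 False le_degree[of "tpoly g" 3] by simp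
    qed
    have Gnz: "g \<noteq> 0" using G0 by auto
    have key: False if PQ: "g = P * Q" and dP: "degree (tpoly P) = 1" and dQ: "degree (tpoly Q) = 2" for P Q
    proof -
      define p0 p1 where "p0 = coeff (tpoly P) 0" and "p1 = coeff (tpoly P) 1"
      define q0 q1 q2 where "q0 = coeff (tpoly Q) 0" and "q1 = coeff (tpoly Q) 1"
        and "q2 = coeff (tpoly Q) 2"
      have p2: "coeff (tpoly P) 2 = 0" using dP by (intro coeff_eq_0) simp
      \<comment> \<open>These are the parts of degree 1 and 2 of \<open>P * Q\<close>; the latter
        vanishes because \<open>g\<close> has no quadratic part.\<close>
      have eqs: "p0 * q1 + p1 * q0 = L" "p0 * q2 + p1 * q1 = 0"
        using c1 c2 p2 unfolding PQ tpoly.hom_mult coeff_mult p0_def p1_def q0_def q1_def q2_def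
        by (simp_all add: numeral_2_eq_2)
      have P: "P = p0 + p1"
        using poly_tpoly_1[of P] unfolding poly_altdef dP p0_def p1_def by simp
      have Q: "Q = q0 + q1 + q2"
        using poly_tpoly_1[of Q] unfolding poly_altdef dQ q0_def q1_def q2_def
        by (simp add: numeral_2_eq_2)
      obtain e r where e: "p0 = Const e" and r: "q0 = Const r"
        unfolding p0_def q0_def coeff_tpoly homog_part_0_eq by blast
      have "degree (tpoly P) \<le> 1" using dP by simp
      from affine_pd_const[OF this] obtain b where b: "pd j P = Const (b j)" for j by blast
      have "degree (tpoly q1) \<le> 1"
        unfolding q1_def coeff_tpoly tpoly_homog_part by (rule degree_monom_le)
      from affine_pd_const[OF this] obtain d where d: "pd j q1 = Const (d j)" for j by blast
      have bp1: "pd j p1 = Const (b j)" for j using b[of j] by (simp add: P e pd_add)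
      have bi: "b i = 0"
      proof (rule ccontr)
        assume "b i \<noteq> 0"
        then obtain u where "Q = Const u"
          using affine_factor_cofactor_const[OF keller b \<open>b i \<noteq> 0\<close> PQ[unfolded g_def]] by blast
        then show False using dQ by simp
      qed
      have p1: "p1 \<noteq> 0"
      proof
        assume "p1 = 0"
        then have "lead_coeff (tpoly P) = 0" by (simp add: dP p1_def)
        then have "tpoly P = 0" by (simp only: leading_coeff_0_iff)
        then show False using dP by simp
      qed
      have piL: "pd i L \<noteq> 0" using lin by (simp add: L_def)
      \<comment> \<open>With \<open>e = 0\<close> the second equation gives \<open>q1 = 0\<close>,
        and then \<open>L\<close> is a multiple of \<open>p1\<close>, which does not involve the
        variable \<open>i\<close>.\<close>
      have e0: "e \<noteq> 0"
      proof
        assume "e = 0"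
        then have "q1 = 0" using eqs(2) p1 e by simp
        then have "L = p1 * Const r" using eqs(1) r by simp
        then have "pd i L = 0" by (simp add: pd_mult bp1 bi)
        then show False using piL by simp
      qed
      have "pd i L = Const (e * d i)"
        unfolding eqs(1)[symmetric] e r by (simp add: pd_add pd_mult bp1 bi d Const.hom_mult)
      then have di: "d i \<noteq> 0" using piL by auto
      obtain k where k: "b k \<noteq> 0"
      proof (rule ccontr)
        assume "\<not> thesis"
        then have "b j = 0" for j using that by blast
        then have "P = Const (lookup P 0)" by (intro const_if_pd_eq_0) (simp add: b)
        then have "degree (tpoly P) = 0" by (simp only: degree_tpoly_eq_0_iff)
        then show False using dP by simp
      qed
      then have ki: "k \<noteq> i" using bi by auto
      from affine_eval[OF b ki] obtain eP where
        eP: "\<forall>\<alpha> \<beta>. subst (\<lambda>v. Const (if v = k then \<alpha> else if v = i then \<beta> else 0)) P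
          = Const (eP + b k * \<alpha> + b i * \<beta>)" ..
      from affine_eval[OF d ki] obtain eq where
        eq: "\<forall>\<alpha> \<beta>. subst (\<lambda>v. Const (if v = k then \<alpha> else if v = i then \<beta> else 0)) q1
          = Const (eq + d k * \<alpha> + d i * \<beta>)" ..
      \<comment> \<open>\<open>\<alpha>\<close> is chosen to make \<open>P\<close> vanish, which is
        unaffected by \<open>\<beta>\<close> because \<open>b i = 0\<close>. Then
        \<open>\<beta>\<close> makes \<open>q1\<close> equal to \<open>- r / 2\<close>, which is
        possible because \<open>d i\<close> is nonzero.\<close>
      define \<alpha> where "\<alpha> = - eP / b k"
      define \<beta> where "\<beta> = (- r / 2 - eq - d k * \<alpha>) / d i"
      define \<sigma> where "\<sigma> = subst (\<lambda>v. Const (if v = k then \<alpha> else if v = i then \<beta> else 0))"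
      have \<sigma>P: "\<sigma> P = 0" using k by (simp add: \<sigma>_def eP[rule_format] bi \<alpha>_def)
      have \<sigma>q1: "\<sigma> q1 = Const (- r / 2)" using di by (simp add: \<sigma>_def eq[rule_format] \<beta>_def)
      have \<sigma>p1: "\<sigma> p1 = - Const e"
      proof -
        have "\<sigma> p1 + Const e = \<sigma> P"
          by (simp only: \<sigma>_def P subst.hom_add e subst_Const add.commute)
        then show ?thesis unfolding \<sigma>P by (rule eq_neg_iff_add_eq_0[THEN iffD2])
      qed
      \<comment> \<open>Replacing \<open>p0 * q2\<close> by \<open>- p1 * q1\<close> eliminates the
        quadratic part. At the chosen point \<open>p1 = - e\<close>, so the right-hand side is
        \<open>e * r + 2 * e * q1\<close>, which is zero for \<open>q1 = - r / 2\<close>.\<close>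
      have "p0 * Q = p0 * q0 + p0 * q1 - p1 * q1"
        unfolding Q distrib_left eq_neg_iff_add_eq_0[THEN iffD2, OF eqs(2)] by simp
      then have "\<sigma> (p0 * Q) = Const e * Const r + Const e * \<sigma> q1 - \<sigma> p1 * \<sigma> q1"
        by (simp add: \<sigma>_def e r subst.hom_add subst.hom_mult subst.hom_minus)
      also have "\<dots> = Const (e * r + e * (- r / 2) + e * (- r / 2))"
        unfolding \<sigma>q1 \<sigma>p1 by (simp only: Const.hom_add Const.hom_mult mult_minus_left diff_minus_eq_add)
      also have "\<dots> = 0" by (simp add: field_simps)
      finally have "\<sigma> Q = 0" using e0 by (simp add: \<sigma>_def e subst.hom_mult)
      with \<sigma>P show False
        using keller_component_no_singular_zero[OF keller PQ[unfolded g_def],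
            of "\<lambda>v. if v = k then \<alpha> else if v = i then \<beta> else 0"]
        unfolding \<sigma>_def by simp
    qed
    show ?thesis
    proof (rule irreducibleI)
      show "g \<noteq> 0" by fact
      show "\<not> g dvd 1" using dG Gnz by (simp add: dvd_1_iff_degree)
      fix P Q assume PQ: "g = P * Q"
      then have nz: "P \<noteq> 0" "Q \<noteq> 0" using Gnz by auto
      then have "degree (tpoly P) + degree (tpoly Q) = 3"
        using degree_tpoly_mult[OF nz] dG by (simp only: PQ)
      then consider "degree (tpoly P) = 0" | "degree (tpoly Q) = 0"
        | "degree (tpoly P) = 1" "degree (tpoly Q) = 2" | "degree (tpoly Q) = 1" "degree (tpoly P) = 2"
        by linarith
      then show "P dvd 1 \<or> Q dvd 1"
      proof cases
        case 3
        then show ?thesis using key[OF PQ] by blast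
      next
        case 4
        have "g = Q * P" using PQ by (simp only: mult.commute)
        then show ?thesis using key[of Q P] 4 by blast
      qed (simp_all add: nz dvd_1_iff_degree)
    qed
  qed
  then show ?thesis by (simp add: g_def)
qed

subsection \<open>The gradient form\<close>

lemma vars_le:
  "vars p \<subseteq> V \<Longrightarrow> vars q \<subseteq> V \<Longrightarrow> vars (p + q) \<subseteq> V"
  "vars p \<subseteq> V \<Longrightarrow> vars q \<subseteq> V \<Longrightarrow> vars (p - q) \<subseteq> V"
  "vars p \<subseteq> V \<Longrightarrow> vars q \<subseteq> V \<Longrightarrow> vars (p * q) \<subseteq> V"
  "(\<And>i. i \<in> I \<Longrightarrow> vars (h i) \<subseteq> V) \<Longrightarrow> vars (sum h I) \<subseteq> V"
  using vars_add[of p q] vars_diff[of p q] vars_mult[of p q] vars_sum[of h I] by blast+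

lemma vars_prod: "vars (\<Prod>i\<in>A. f i) \<subseteq> (\<Union>i\<in>A. vars (f i))"
proof (cases "finite A")
  case True
  then show ?thesis
  proof induction
    case (insert i A)
    then show ?case using vars_mult[of "f i" "prod f A"] by auto
  qed simp
qed simp

lemma vars_of_int [simp]: "vars (of_int k :: 'a::comm_ring_1 mpoly) = {}"
  by (metis Const.hom_of_int vars_Const)

lemma vars_jac_det:
  assumes "\<And>i. i < n \<Longrightarrow> vars (F i) \<subseteq> V"
  shows "vars (jac_det n F) \<subseteq> V"
proof -
  have "vars (of_int (sign \<pi>) * (\<Prod>i<n. pd (\<pi> i) (F i))) \<subseteq> V" for \<pi>
  proof -
    have "vars (of_int (sign \<pi>) * (\<Prod>i<n. pd (\<pi> i) (F i)))
        \<subseteq> vars (\<Prod>i<n. pd (\<pi> i) (F i))"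
      using vars_mult[of "of_int (sign \<pi>)" "\<Prod>i<n. pd (\<pi> i) (F i)"] by simp
    also have "\<dots> \<subseteq> (\<Union>i<n. vars (pd (\<pi> i) (F i)))" by (rule vars_prod)
    also have "\<dots> \<subseteq> V" using assms vars_pd by fastforce
    finally show ?thesis .
  qed
  then show ?thesis unfolding jac_det_def using vars_sum by fastforce
qed

text \<open>Dividing the adjugate by the constant determinant gives a polynomial inverse.\<close>

lemma keller_inverse_jacobian:
  fixes F :: "nat \<Rightarrow> 'a::field mpoly"
  assumes "keller n F"
  shows "\<exists>W. (\<forall>i j. vars (W i j) \<subseteq> {..<n}) \<and>
    (\<forall>i<n. \<forall>j<n. (\<Sum>k<n. pd k (F i) * W k j) = (if i = j then 1 else 0)) \<and>
    (\<forall>i<n. \<forall>j<n. (\<Sum>k<n. W i k * pd j (F k)) = (if i = j then 1 else 0))"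
proof -
  obtain c where c: "c \<noteq> 0" "jac_det n F = Const c" using assms by (auto simp: keller_def)
  define J where "J = jac_mat n F"
  have J: "J \<in> carrier_mat n n" "det J = Const c" by (simp_all add: J_def det_jac_mat c)
  have e: "J $$ (i, k) = pd k (F i)" if "i < n" "k < n" for i k
    using that by (simp add: J_def jac_mat_def)
  have pr: "subst (\<lambda>v. if v < n then Var v else 0) (pd k (F i)) = pd k (F i)" if "i < n" for i k
    by (rule subst_id[of _ "{..<n}"])
      (use that assms vars_pd[of k "F i"] in \<open>auto simp: keller_def polymap_def\<close>)
  \<comment> \<open>Setting the variables outside \<open>{..<n}\<close> to zero fixes the entries of
    the Jacobian, so the inverse identities survive, and it confines the entries of \<open>W\<close>
    to the first \<open>n\<close> variables.\<close>
  define W where "W i j = Const (inverse c) * subst (\<lambda>v. if v < n then Var v else 0) (adj_mat J $$ (i, j))" for i j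
  have cc: "Const (inverse c) * Const c = 1" using Const_inverse[OF c(1)] by (simp only: mult.commute)
  show ?thesis
  proof (intro exI[of _ W] conjI allI impI)
    fix i j
    have "vars (subst (\<lambda>v. if v < n then Var v else 0) (adj_mat J $$ (i, j))) \<subseteq> {..<n}"
      by (rule vars_subst[OF subset_UNIV]) auto
    then show "vars (W i j) \<subseteq> {..<n}"
      unfolding W_def using vars_mult[of "Const (inverse c)"] by fastforce
    assume ij: "i < n" "j < n"
    have "(\<Sum>k<n. pd k (F i) * W k j) = Const (inverse c) *
        subst (\<lambda>v. if v < n then Var v else 0) (\<Sum>k<n. J $$ (i, k) * adj_mat J $$ (k, j))"
      unfolding W_def subst.hom_sum subst.hom_mult sum_distrib_left
      using ij by (intro sum.cong refl) (simp add: e pr)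
    also have "\<dots> = (if i = j then 1 else 0)"
      unfolding adj_mat_mult_entry(1)[OF J(1) ij] J(2) using cc by simp
    finally show "(\<Sum>k<n. pd k (F i) * W k j) = (if i = j then 1 else 0)" .
    have "(\<Sum>k<n. W i k * pd j (F k)) = Const (inverse c) *
        subst (\<lambda>v. if v < n then Var v else 0) (\<Sum>k<n. adj_mat J $$ (i, k) * J $$ (k, j))"
      unfolding W_def subst.hom_sum subst.hom_mult sum_distrib_left
      using ij by (intro sum.cong refl) (simp add: e pr)
    also have "\<dots> = (if i = j then 1 else 0)"
      unfolding adj_mat_mult_entry(2)[OF J(1) ij] J(2) using cc by simp
    finally show "(\<Sum>k<n. W i k * pd j (F k)) = (if i = j then 1 else 0)" .
  qed
qed

section \<open>Derivatives and Jacobian determinant of the gradient form\<close>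

locale gradient_form =
  fixes n :: nat and f :: "'a::field_char_0 mpoly" and F :: "nat \<Rightarrow> 'a mpoly" and u u' :: 'a
  assumes vars_f: "vars f \<subseteq> {..<n}" and vars_F: "\<And>j. j < n \<Longrightarrow> vars (F j) \<subseteq> {..<n}"
begin

definition X :: "nat \<Rightarrow> 'a mpoly" where "X j = Var j + Const u * Var (n + j)"
definition Y :: "nat \<Rightarrow> 'a mpoly" where "Y j = Var j + Const u' * Var (n + j)"
definition g where "g = subst X f + (\<Sum>j<n. Y j * subst X (F j))"
text \<open>With \<open>X\<close> and \<open>Y\<close> treated as independent, this is the
  derivative of \<open>g\<close> in \<open>X i\<close>; the derivative in \<open>Y i\<close> is
  \<open>subst X (F i)\<close>.\<close>

definition A where "A i = subst X (pd i f) + (\<Sum>j<n. Y j * subst X (pd i (F j)))"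

lemma pd_X: "i < n \<Longrightarrow> j < n \<Longrightarrow> pd i (X j) = (if i = j then 1 else 0)"
  "i < n \<Longrightarrow> j < n \<Longrightarrow> pd (n + i) (X j) = (if i = j then Const u else 0)"
  by (simp_all add: X_def pd_add pd_Var)

lemma pd_Y: "i < n \<Longrightarrow> j < n \<Longrightarrow> pd i (Y j) = (if i = j then 1 else 0)"
  "i < n \<Longrightarrow> j < n \<Longrightarrow> pd (n + i) (Y j) = (if i = j then Const u' else 0)"
  by (simp_all add: Y_def pd_add pd_Var)

lemma pd_subst_X:
  assumes "i < n" "vars p \<subseteq> {..<n}"
  shows "pd i (subst X p) = subst X (pd i p)" "pd (n + i) (subst X p) = Const u * subst X (pd i p)"
  unfolding pd_subst[OF assms(2) finite_lessThan]
  using assms(1) by (simp_all add: pd_X if_distrib if_distribR mult.commute sum.If_cases cong: if_cong)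

lemma vars_pd_F: "j < n \<Longrightarrow> vars (pd i (F j)) \<subseteq> {..<n}"
  using vars_F vars_pd by blast

lemma vars_pd_f: "vars (pd i f) \<subseteq> {..<n}"
  using vars_f vars_pd by blast

lemma pd_g:
  assumes "i < n"
  shows "pd i g = A i + subst X (F i)" "pd (n + i) g = Const u * A i + Const u' * subst X (F i)"
proof -
  have "(\<Sum>j<n. pd i (Y j * subst X (F j)))
      = (\<Sum>j<n. (if j = i then subst X (F j) else 0) + Y j * subst X (pd i (F j)))"
    using assms by (intro sum.cong refl) (auto simp: pd_mult pd_Y pd_subst_X vars_F)
  also have "\<dots> = subst X (F i) + (\<Sum>j<n. Y j * subst X (pd i (F j)))"
    unfolding sum.distrib using assms by simp
  finally show "pd i g = A i + subst X (F i)"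
    using assms by (simp add: g_def A_def pd_add pd_sum pd_subst_X vars_f)
  have "(\<Sum>j<n. pd (n + i) (Y j * subst X (F j)))
      = (\<Sum>j<n. (if j = i then Const u' * subst X (F j) else 0) + Const u * (Y j * subst X (pd i (F j))))"
    using assms by (intro sum.cong refl) (auto simp: pd_mult pd_Y pd_subst_X vars_F mult_ac)
  also have "\<dots> = Const u' * subst X (F i) + Const u * (\<Sum>j<n. Y j * subst X (pd i (F j)))"
    unfolding sum.distrib sum_distrib_left[symmetric] using assms by simp
  finally show "pd (n + i) g = Const u * A i + Const u' * subst X (F i)"
    using assms by (simp add: g_def A_def pd_add pd_sum pd_subst_X vars_f distrib_left)
qed

text \<open>The second derivative of \<open>g\<close> in \<open>X i\<close> and \<open>X j\<close>,
  with \<open>Y\<close> held fixed.\<close>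

definition S where
  "S i j = subst X (pd j (pd i f)) + (\<Sum>k<n. Y k * subst X (pd j (pd i (F k))))"

lemma pd_A:
  assumes "i < n" "j < n"
  shows "pd j (A i) = S i j + subst X (pd i (F j))"
    "pd (n + j) (A i) = Const u * S i j + Const u' * subst X (pd i (F j))"
proof -
  have "(\<Sum>k<n. pd j (Y k * subst X (pd i (F k))))
      = (\<Sum>k<n. (if k = j then subst X (pd i (F k)) else 0) + Y k * subst X (pd j (pd i (F k))))"
    using assms by (intro sum.cong refl) (auto simp: pd_mult pd_Y pd_subst_X vars_pd_F)
  also have "\<dots> = subst X (pd i (F j)) + (\<Sum>k<n. Y k * subst X (pd j (pd i (F k))))"
    unfolding sum.distrib using assms by simp
  finally show "pd j (A i) = S i j + subst X (pd i (F j))"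
    using assms by (simp add: S_def A_def pd_add pd_sum pd_subst_X vars_pd_f)
  have "(\<Sum>k<n. pd (n + j) (Y k * subst X (pd i (F k))))
      = (\<Sum>k<n. (if k = j then Const u' * subst X (pd i (F k)) else 0)
          + Const u * (Y k * subst X (pd j (pd i (F k)))))"
    using assms by (intro sum.cong refl) (auto simp: pd_mult pd_Y pd_subst_X vars_pd_F mult_ac)
  also have "\<dots> = Const u' * subst X (pd i (F j)) + Const u * (\<Sum>k<n. Y k * subst X (pd j (pd i (F k))))"
    unfolding sum.distrib sum_distrib_left[symmetric] using assms by simp
  finally show "pd (n + j) (A i) = Const u * S i j + Const u' * subst X (pd i (F j))"
    using assms by (simp add: S_def A_def pd_add pd_sum pd_subst_X vars_pd_f distrib_left)
qed

text \<open>In the coordinates \<open>X\<close> and \<open>y\<close> one has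
  \<open>Y = X + (u' - u) y\<close>, and \<open>g\<close> is affine in \<open>y\<close>, so its
  Hessian has a zero block. Using \<open>y\<close> rather than \<open>Y\<close> as second coordinate
  also covers \<open>u = u'\<close>, which is only excluded afterwards by means of this
  formula.\<close>

lemma jac_det_gradient:
  assumes G: "\<And>i. i < n \<Longrightarrow> G i = A i + subst X (F i)"
    "\<And>i. i < n \<Longrightarrow> G (n + i) = Const u * A i + Const u' * subst X (F i)"
  shows "jac_det (n + n) G = (- (Const (u' - u) ^ 2)) ^ n * subst X (jac_det n F) ^ 2"
proof -
  define M where "M = map_mat (subst X) (jac_mat n F)"
  define B where "B = mat n n (\<lambda>(i, j). S i j + subst X (pd i (F j)) + subst X (pd j (F i)))"
  have M: "M \<in> carrier_mat n n" and B: "B \<in> carrier_mat n n"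
    by (simp_all add: M_def B_def jac_mat_def)
  have Me: "M $$ (i, j) = subst X (pd j (F i))" if "i < n" "j < n" for i j
    using that by (simp add: M_def jac_mat_def)
  have Be: "B $$ (i, j) = S i j + subst X (pd i (F j)) + subst X (pd j (F i))" if "i < n" "j < n" for i j
    using that by (simp add: B_def)
  define w where "w = Const (u' - u)"
  have w: "w = Const u' - Const u" by (simp add: w_def Const.hom_minus)
  define T1 where "T1 = four_block_mat (1\<^sub>m n) (0\<^sub>m n n) (Const u \<cdot>\<^sub>m 1\<^sub>m n) (1\<^sub>m n :: 'a mpoly mat)"
  define T2 where "T2 = four_block_mat (1\<^sub>m n) (Const u \<cdot>\<^sub>m 1\<^sub>m n) (0\<^sub>m n n) (1\<^sub>m n :: 'a mpoly mat)"
  \<comment> \<open>\<open>Z\<close> is the Hessian in the coordinates \<open>X\<close>,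
    \<open>y\<close>, and \<open>T1\<close>, \<open>T2\<close> are the matrices of the substitution
    \<open>X = x + u y\<close> on either side.\<close>
  define Z where "Z = four_block_mat B (w \<cdot>\<^sub>m M\<^sup>T) (w \<cdot>\<^sub>m M) (0\<^sub>m n n)"
  have T1: "T1 \<in> carrier_mat (n + n) (n + n)" and T2: "T2 \<in> carrier_mat (n + n) (n + n)"
    and Z: "Z \<in> carrier_mat (n + n) (n + n)"
    using B by (simp_all add: T1_def T2_def Z_def)
  have d1: "det T1 = 1"
    unfolding T1_def by (subst det_four_block_mat_upper_right_zero[of _ n _ n]) auto
  have d2: "det T2 = 1"
    unfolding T2_def by (subst det_four_block_mat_lower_left_zero[of _ n _ n]) auto
  have T1Z: "T1 * Z = four_block_mat B (w \<cdot>\<^sub>m M\<^sup>T) (Const u \<cdot>\<^sub>m B + w \<cdot>\<^sub>m M) (Const u \<cdot>\<^sub>m (w \<cdot>\<^sub>m M\<^sup>T))"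
    unfolding T1_def Z_def using M B mult_smult_assoc_mat[OF one_carrier_mat, of _ n n "Const u"]
    by (subst mult_four_block_mat[of _ n n _ n _ n _ _ n _ n]) auto
  have T1ZT2: "T1 * Z * T2 = four_block_mat B (Const u \<cdot>\<^sub>m B + w \<cdot>\<^sub>m M\<^sup>T) (Const u \<cdot>\<^sub>m B + w \<cdot>\<^sub>m M)
      (Const u \<cdot>\<^sub>m (Const u \<cdot>\<^sub>m B + w \<cdot>\<^sub>m M) + Const u \<cdot>\<^sub>m (w \<cdot>\<^sub>m M\<^sup>T))"
    unfolding T1Z T2_def using M B
    by (subst mult_four_block_mat[of _ n n _ n _ n _ _ n _ n]) auto
  have "jac_mat (n + n) G = T1 * Z * T2"
  proof (rule eq_matI)
    fix i j
    assume "i < dim_row (T1 * Z * T2)" "j < dim_col (T1 * Z * T2)"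
    then have "i < n + n" "j < n + n" using T1 T2 by auto
    then consider "i < n" "j < n" | "i < n" "n \<le> j" "j - n < n" | "n \<le> i" "i - n < n" "j < n"
      | "n \<le> i" "i - n < n" "n \<le> j" "j - n < n" by linarith
    then show "jac_mat (n + n) G $$ (i, j) = (T1 * Z * T2) $$ (i, j)"
    proof cases
      case 1
      then show ?thesis unfolding T1ZT2 using M B
        by (simp add: jac_mat_def Be G pd_add pd_A pd_subst_X vars_F)
    next
      case 2
      define k where "k = j - n"
      have j: "j = n + k" "k < n" using 2 by (auto simp: k_def)
      show ?thesis unfolding T1ZT2 using M B 2(1) j(2)
        by (simp add: j(1) jac_mat_def Be Me G pd_add pd_A pd_subst_X vars_F w) (simp add: algebra_simps)
    next
      case 3
      define k where "k = i - n"
      have i: "i = n + k" "k < n" using 3 by (auto simp: k_def)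
      show ?thesis unfolding T1ZT2 using M B 3(3) i(2)
        by (simp add: i(1) jac_mat_def Be Me G pd_add pd_A pd_subst_X vars_F w) (simp add: algebra_simps)
    next
      case 4
      define k l where "k = i - n" and "l = j - n"
      have i: "i = n + k" "k < n" and j: "j = n + l" "l < n" using 4 by (auto simp: k_def l_def)
      show ?thesis unfolding T1ZT2 using M B i(2) j(2)
        by (simp add: i(1) j(1) jac_mat_def Be Me G pd_add pd_A pd_subst_X vars_F w) (simp add: algebra_simps)
    qed
  qed (use T1 T2 in \<open>auto simp: jac_mat_def\<close>)
  then have "jac_det (n + n) G = det (T1 * Z * T2)" by (simp flip: det_jac_mat)
  also have "\<dots> = det T1 * det Z * det T2"
    by (simp only: det_mult[OF mult_carrier_mat[OF T1 Z] T2] det_mult[OF T1 Z])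
  also have "\<dots> = det Z" by (simp only: d1 d2 mult_1 mult_1_right)
  \<comment> \<open>The block formula applies because the zero block commutes with the block beside
    it.\<close>
  also have "\<dots> = det (B * 0\<^sub>m n n - (w \<cdot>\<^sub>m M\<^sup>T) * (w \<cdot>\<^sub>m M))"
    unfolding Z_def by (rule det_four_block_mat) (use B M in auto)
  also have "B * 0\<^sub>m n n - (w \<cdot>\<^sub>m M\<^sup>T) * (w \<cdot>\<^sub>m M) = (- (w ^ 2)) \<cdot>\<^sub>m (M\<^sup>T * M)"
    using B M by (intro eq_matI) (auto simp: power2_eq_square mult_ac scalar_prod_def sum_distrib_left simp flip: sum_negf)
  also have "det \<dots> = (- (w ^ 2)) ^ n * (det M * det M)"
    using M by (simp add: det_mult[of _ n] det_transpose[OF M])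
  also have "det M = subst X (jac_det n F)" by (simp add: M_def det_jac_mat)
  finally show ?thesis by (simp add: w_def power2_eq_square)
qed

lemma subst_subst_X:
  assumes "\<And>v. v < n \<Longrightarrow> subst s (X v) = t v" "vars p \<subseteq> {..<n}"
  shows "subst s (subst X p) = subst t p"
  unfolding subst_subst by (rule subst_cong[OF assms(2)]) (simp add: assms(1))

text \<open>A nonzero constant is a unit. Hence the factor \<open>u' - u\<close>, present because
  \<open>n \<ge> 1\<close>, is nonzero, and the Jacobian determinant of \<open>F\<close> at
  \<open>X\<close> is a unit too.\<close>

lemma jacobian_F_if_keller:
  assumes n: "n \<ge> 1" and det: "c \<noteq> 0"
    "Const c = (- (Const (u' - u) ^ 2)) ^ n * subst X (jac_det n F) ^ 2"
  shows "u \<noteq> u'" "keller n F"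
proof -
  show "u \<noteq> u'"
  proof
    assume "u = u'"
    then have "Const c = 0" unfolding det(2) using n by simp
    with det(1) show False by simp
  qed
  have "subst X (jac_det n F) dvd Const c"
    unfolding det(2) power2_eq_square by simp
  moreover have "Const c dvd (1 :: 'a mpoly)" using det(1) by (auto simp: dvd_1_iff_Const)
  ultimately have "subst X (jac_det n F) dvd 1" by (rule dvd_trans)
  then obtain d where d: "d \<noteq> 0" "subst X (jac_det n F) = Const d"
    by (auto simp: dvd_1_iff_Const)
  \<comment> \<open>Setting \<open>y\<close> to zero maps \<open>X j\<close> back to
    \<open>Var j\<close> and so undoes the substitution \<open>X\<close>.\<close>
  have "subst (\<lambda>v. if v < n then Var v else 0) (subst X (jac_det n F)) = subst Var (jac_det n F)"
    using vars_F by (intro subst_subst_X vars_jac_det) (simp_all add: X_def subst.hom_add subst.hom_mult)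
  also have "\<dots> = jac_det n F" by (rule subst_id[OF subset_UNIV]) simp
  finally have "jac_det n F = Const d" by (simp add: d)
  with d(1) show "keller n F" using vars_F by (auto simp: keller_def polymap_def)
qed

end

text \<open>Solutions of 2 by 2 linear systems with determinant \<open>c - c'\<close> and inverse
  \<open>k\<close>, up to sign. The first four pass between \<open>x\<close>, \<open>y\<close> and
  \<open>X\<close>, \<open>Y\<close>; the next four between the pair \<open>G i\<close>,
  \<open>G (n + i)\<close> and the pair \<open>A i\<close>, \<open>F i\<close> at \<open>X\<close>;
  the last is the case \<open>A i = 0\<close>.\<close>

lemma coordinate_identities:
  fixes c c' k x y :: "'b::comm_ring_1"
  assumes "(c - c') * k = 1"
  shows "k * (c * y - c' * x) + c * (k * (x - y)) = x"
    "k * (c * y - c' * x) + c' * (k * (x - y)) = y"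
    "k * (c * (x + c' * y) - c' * (x + c * y)) = x"
    "k * ((x + c * y) - (x + c' * y)) = y"
    "k * (c * (y + x) - (c * y + c' * x)) = x"
    "k * (c * y + c' * x - c' * (y + x)) = y"
    "k * (y - c' * x) + k * (c * x - y) = x"
    "c * (k * (y - c' * x)) + c' * (k * (c * x - y)) = y"
    "k * (c * x - c' * x) = x"
proof -
  have e: "(c - c') * k * z = z" for z using assms by simp
  show "k * (c * y - c' * x) + c * (k * (x - y)) = x"
    by (rule trans[OF _ e[of x]]) (simp add: algebra_simps)
  show "k * (c * y - c' * x) + c' * (k * (x - y)) = y"
    by (rule trans[OF _ e[of y]]) (simp add: algebra_simps)
  show "k * (c * (x + c' * y) - c' * (x + c * y)) = x"
    by (rule trans[OF _ e[of x]]) (simp add: algebra_simps)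
  show "k * ((x + c * y) - (x + c' * y)) = y"
    by (rule trans[OF _ e[of y]]) (simp add: algebra_simps)
  show "k * (c * (y + x) - (c * y + c' * x)) = x"
    by (rule trans[OF _ e[of x]]) (simp add: algebra_simps)
  show "k * (c * y + c' * x - c' * (y + x)) = y"
    by (rule trans[OF _ e[of y]]) (simp add: algebra_simps)
  show "k * (y - c' * x) + k * (c * x - y) = x"
    by (rule trans[OF _ e[of x]]) (simp add: algebra_simps)
  show "c * (k * (y - c' * x)) + c' * (k * (c * x - y)) = y"
    by (rule trans[OF _ e[of y]]) (simp add: algebra_simps)
  show "k * (c * x - c' * x) = x"
    by (rule trans[OF _ e[of x]]) (simp add: algebra_simps)
qed

section \<open>Adapted coordinates and the transfer of invertibility\<close>

locale gradient_map = gradient_form +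
  fixes G :: "nat \<Rightarrow> 'a mpoly"
  assumes u_neq: "u \<noteq> u'" and keller_F: "keller n F"
    and G_x: "\<And>i. i < n \<Longrightarrow> G i = A i + subst X (F i)"
    and G_y: "\<And>i. i < n \<Longrightarrow> G (n + i) = Const u * A i + Const u' * subst X (F i)"
begin

text \<open>A polynomial inverse of the Jacobian matrix of \<open>F\<close>.\<close>

definition W :: "nat \<Rightarrow> nat \<Rightarrow> 'a mpoly" where
  "W = (SOME W. (\<forall>i j. vars (W i j) \<subseteq> {..<n}) \<and>
    (\<forall>i<n. \<forall>j<n. (\<Sum>k<n. pd k (F i) * W k j) = (if i = j then 1 else 0)) \<and>
    (\<forall>i<n. \<forall>j<n. (\<Sum>k<n. W i k * pd j (F k)) = (if i = j then 1 else 0)))"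

lemma vars_W: "vars (W i j) \<subseteq> {..<n}"
  and W_right: "i < n \<Longrightarrow> j < n \<Longrightarrow> (\<Sum>k<n. pd k (F i) * W k j) = (if i = j then 1 else 0)"
  and W_left: "i < n \<Longrightarrow> j < n \<Longrightarrow> (\<Sum>k<n. W i k * pd j (F k)) = (if i = j then 1 else 0)"
  using someI_ex[OF keller_inverse_jacobian[OF keller_F]] unfolding W_def[symmetric] by blast+

definition \<kappa> :: "'a mpoly" where "\<kappa> = Const (inverse (u - u'))"

lemma \<kappa>: "(Const u - Const u') * \<kappa> = 1"
  using Const_inverse[of "u - u'"] u_neq by (simp add: \<kappa>_def Const.hom_minus)

lemmas coord = coordinate_identities[OF \<kappa>]

lemma vars_X: "j < n \<Longrightarrow> vars (X j) \<subseteq> {..<n + n}" and vars_Y: "j < n \<Longrightarrow> vars (Y j) \<subseteq> {..<n + n}"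
  unfolding X_def Y_def by (intro vars_le; simp)+

lemma vars_\<kappa> [simp]: "vars \<kappa> = {}"
  by (simp add: \<kappa>_def)

lemma subst_\<kappa> [simp]: "subst s \<kappa> = \<kappa>"
  by (simp add: \<kappa>_def)

lemma FX_eq: "i < n \<Longrightarrow> subst X (F i) = \<kappa> * (Const u * G i - G (n + i))"
  by (simp only: G_x G_y coord)

lemma A_eq: "i < n \<Longrightarrow> A i = \<kappa> * (G (n + i) - Const u' * G i)"
  by (simp only: G_x G_y coord)

text \<open>The point whose \<open>X\<close>- and \<open>Y\<close>-coordinates are \<open>a\<close> and \<open>b\<close>.\<close>

definition pt :: "(nat \<Rightarrow> 'a mpoly) \<Rightarrow> (nat \<Rightarrow> 'a mpoly) \<Rightarrow> nat \<Rightarrow> 'a mpoly" where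
  "pt a b v = (if v < n then \<kappa> * (Const u * b v - Const u' * a v)
     else \<kappa> * (a (v - n) - b (v - n)))"

lemma subst_pt_X: "j < n \<Longrightarrow> subst (pt a b) (X j) = a j"
  by (simp add: X_def subst.hom_add subst.hom_mult pt_def coord)

lemma subst_pt_Y: "j < n \<Longrightarrow> subst (pt a b) (Y j) = b j"
  by (simp add: Y_def subst.hom_add subst.hom_mult pt_def coord)

lemma pt_X_Y: "v < n + n \<Longrightarrow> pt X Y v = Var v"
proof (cases "v < n")
  case True
  then show ?thesis by (simp add: pt_def X_def Y_def coord)
next
  case False
  assume "v < n + n"
  then obtain w where v: "v = n + w" "w < n" using False less_imp_add_positive
    by (metis add_less_cancel_left le_add_diff_inverse linorder_not_less)
  then have "pt X Y v = \<kappa> * (X w - Y w)" by (simp add: pt_def)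
  also have "\<dots> = Var v" by (simp only: X_def Y_def coord v)
  finally show ?thesis .
qed

lemma subst_A:
  assumes "\<And>v. v < n \<Longrightarrow> subst s (X v) = a v" "i < n"
  shows "subst s (A i) = subst a (pd i f) + (\<Sum>j<n. subst s (Y j) * subst a (pd i (F j)))"
  unfolding A_def subst.hom_add subst.hom_sum subst.hom_mult
  using assms by (simp add: subst_subst_X vars_pd_f vars_pd_F)

text \<open>\<open>A i\<close> is affine in \<open>Y\<close> with the transposed Jacobian of
  \<open>F\<close> as coefficient matrix, so the transposed inverse solves for \<open>Y\<close> at
  \<open>X = a\<close>.\<close>

lemma sum_W_solve:
  assumes "i < n"
  shows "(\<Sum>j<n. (\<Sum>l<n. subst a (W l j) * b l) * subst a (pd i (F j))) = b i"
proof -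
  have "(\<Sum>j<n. (\<Sum>l<n. subst a (W l j) * b l) * subst a (pd i (F j)))
      = (\<Sum>l<n. b l * subst a (\<Sum>j<n. W l j * pd i (F j)))"
    unfolding sum_distrib_right sum_distrib_left subst.hom_sum subst.hom_mult
    by (subst sum.swap) (simp only: mult_ac)
  also have "\<dots> = (\<Sum>l<n. if l = i then b l else 0)"
    using assms by (intro sum.cong refl) (simp add: W_left)
  also have "\<dots> = b i" using assms by simp
  finally show ?thesis .
qed

text \<open>From the values of \<open>G\<close>, the forms \<open>r\<close> and \<open>s\<close>
  recover \<open>F\<close> at \<open>X\<close> and \<open>A\<close>. The inverse of \<open>F\<close>
  then yields \<open>X\<close>, the inverse Jacobian yields \<open>Y\<close>, and \<open>pt\<close>
  returns to the original variables.\<close>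

lemma invertible_gradient_if:
  assumes "invertible_polymap n F"
  shows "invertible_polymap (n + n) G"
proof -
  obtain H where H: "polymap n H" "\<And>i. i < n \<Longrightarrow> subst F (H i) = Var i"
      "\<And>i. i < n \<Longrightarrow> subst H (F i) = Var i"
    using assms by (auto simp: invertible_polymap_def)
  have vH: "vars (H j) \<subseteq> {..<n}" if "j < n" for j using H(1) that by (auto simp: polymap_def)
  define r where "r i = \<kappa> * (Const u * Var i - Var (n + i))" for i
  define s where "s i = \<kappa> * (Var (n + i) - Const u' * Var i)" for i
  define a where "a j = subst r (H j)" for j
  \<comment> \<open>\<open>b\<close> is the value of \<open>Y\<close> for which \<open>A\<close>
    takes the value \<open>s\<close> at \<open>X = a\<close>.\<close>
  define b where "b j = (\<Sum>l<n. subst a (W l j) * (s l - subst a (pd l f)))" for j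
  define K where "K = pt a b"
  have Gr: "subst G (r i) = subst X (F i)" if "i < n" for i
    using that by (simp add: r_def FX_eq subst.hom_mult subst.hom_minus)
  have Gs: "subst G (s i) = A i" if "i < n" for i
    using that by (simp add: s_def A_eq subst.hom_mult subst.hom_minus)
  have Ga: "subst G (a j) = X j" if "j < n" for j
  proof -
    have "subst G (a j) = subst (\<lambda>i. subst X (F i)) (H j)"
      unfolding a_def subst_subst by (rule subst_cong[OF vH[OF that]]) (simp add: Gr)
    also have "\<dots> = X j" using H(2)[OF that] by (simp flip: subst_subst)
    finally show ?thesis .
  qed
  have Gap: "subst G (subst a p) = subst X p" if "vars p \<subseteq> {..<n}" for p
    unfolding subst_subst by (rule subst_cong[OF that]) (simp add: Ga)
  have Gb: "subst G (b j) = Y j" if "j < n" for j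
  proof -
    have "subst G (b j) = (\<Sum>l<n. subst X (W l j) * (A l - subst X (pd l f)))"
      unfolding b_def subst.hom_sum subst.hom_mult subst.hom_minus
      by (intro sum.cong refl) (simp add: Gap vars_W vars_pd_f Gs)
    also have "\<dots> = (\<Sum>l<n. \<Sum>k<n. Y k * (subst X (pd l (F k)) * subst X (W l j)))"
      unfolding A_def by (intro sum.cong refl) (simp add: sum_distrib_left mult_ac)
    also have "\<dots> = (\<Sum>k<n. Y k * subst X (\<Sum>l<n. pd l (F k) * W l j))"
      unfolding sum_distrib_left subst.hom_sum subst.hom_mult by (rule sum.swap)
    also have "\<dots> = (\<Sum>k<n. if k = j then Y k else 0)"
      using that by (intro sum.cong refl) (simp add: W_right)
    also have "\<dots> = Y j" using that by simp
    finally show ?thesis .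
  qed
  have vr: "vars (r j) \<subseteq> {..<n + n}" "vars (s j) \<subseteq> {..<n + n}" if "j < n" for j
    unfolding r_def s_def using that by (intro vars_le; simp)+
  have va: "vars (a j) \<subseteq> {..<n + n}" if "j < n" for j
    unfolding a_def by (rule vars_subst[OF vH[OF that]]) (simp add: vr)
  have va': "vars (subst a p) \<subseteq> {..<n + n}" if "vars p \<subseteq> {..<n}" for p
    by (rule vars_subst[OF that]) (simp add: va)
  have vb: "vars (b j) \<subseteq> {..<n + n}" if "j < n" for j
    unfolding b_def by (intro vars_le va' vars_W vars_pd_f vr) simp
  have vK: "vars (K v) \<subseteq> {..<n + n}" if "v < n + n" for v
    unfolding K_def pt_def using that
    by (cases "v < n"; simp only: if_True if_False; intro vars_le va vb; simp)
  have KX: "subst K (X j) = a j" and KY: "subst K (Y j) = b j" if "j < n" for j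
    using that by (simp_all add: K_def subst_pt_X subst_pt_Y)
  have KF: "subst K (subst X (F i)) = r i" if "i < n" for i
  proof -
    have "subst K (subst X (F i)) = subst a (F i)"
      by (rule subst_subst_X) (use KX vars_F that in auto)
    also have "\<dots> = subst r (subst H (F i))"
      unfolding subst_subst a_def by simp
    also have "\<dots> = r i" using H(3)[OF that] by simp
    finally show ?thesis .
  qed
  have KA: "subst K (A i) = s i" if "i < n" for i
  proof -
    have "subst K (A i) = subst a (pd i f) + (\<Sum>j<n. subst K (Y j) * subst a (pd i (F j)))"
      by (rule subst_A) (use KX that in auto)
    also have "(\<Sum>j<n. subst K (Y j) * subst a (pd i (F j)))
        = (\<Sum>j<n. (\<Sum>l<n. subst a (W l j) * (s l - subst a (pd l f))) * subst a (pd i (F j)))"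
      by (intro sum.cong refl) (simp add: KY b_def)
    also have "\<dots> = s i - subst a (pd i f)" by (rule sum_W_solve[OF that])
    finally show ?thesis by simp
  qed
  have GK: "subst G (K v) = Var v" if "v < n + n" for v
  proof -
    have "subst G (K v) = pt X Y v"
      using that by (auto simp: K_def pt_def subst.hom_mult subst.hom_minus Ga Gb)
    then show ?thesis using pt_X_Y[OF that] by simp
  qed
  have KG: "subst K (G v) = Var v" if "v < n + n" for v
  proof (cases "v < n")
    case True
    then have "subst K (G v) = s v + r v" by (simp add: G_x subst.hom_add KA KF)
    then show ?thesis by (simp only: r_def s_def coord)
  next
    case False
    define w where "w = v - n"
    have v: "v = n + w" "w < n" using False that by (auto simp: w_def)
    then have "subst K (G v) = Const u * s w + Const u' * r w"
      by (simp add: G_y subst.hom_add subst.hom_mult KA KF)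
    then show ?thesis by (simp only: r_def s_def v(1) coord)
  qed
  have vG: "vars (G v) \<subseteq> {..<n + n}" if "v < n + n" for v
  proof (cases "v < n")
    case True
    then show ?thesis unfolding G_x[OF True] A_def
      by (intro vars_le vars_subst[OF vars_pd_f] vars_subst[OF vars_pd_F] vars_subst[OF vars_F])
        (simp_all add: vars_X vars_Y)
  next
    case False
    define w where "w = v - n"
    have v: "v = n + w" "w < n" using False that by (auto simp: w_def)
    show ?thesis unfolding v(1) G_y[OF v(2)] A_def using v(2)
      by (intro vars_le vars_subst[OF vars_pd_f] vars_subst[OF vars_pd_F] vars_subst[OF vars_F])
        (simp_all add: vars_X vars_Y)
  qed
  show ?thesis
    unfolding invertible_polymap_def polymap_def using vG vK GK KG by blast
qed

text \<open>The inverse of \<open>F\<close> is the \<open>X\<close>-coordinate of the inverse of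
  \<open>G\<close>, restricted to the values of \<open>G\<close> where \<open>A\<close> is
  zero.\<close>

lemma invertible_if_gradient:
  assumes "invertible_polymap (n + n) G"
  shows "invertible_polymap n F"
proof -
  obtain K where K: "polymap (n + n) K" "\<And>i. i < n + n \<Longrightarrow> subst G (K i) = Var i"
      "\<And>i. i < n + n \<Longrightarrow> subst K (G i) = Var i"
    using assms by (auto simp: invertible_polymap_def)
  have vK: "vars (K j) \<subseteq> {..<n + n}" if "j < n + n" for j using K(1) that by (auto simp: polymap_def)
  \<comment> \<open>\<open>z\<close> encodes the value of \<open>G\<close> with \<open>A = 0\<close>
    and \<open>F\<close> at \<open>X\<close> equal to the variables, that is, the pair
    \<open>Var i\<close>, \<open>u' Var i\<close>.\<close>
  define z where "z v = (if v < n then Var v else Const u' * Var (v - n))" for v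
  define H where "H j = subst z (subst K (X j))" for j
  have KX: "subst K (X j) = K j + Const u * K (n + j)" for j
    by (simp add: X_def subst.hom_add subst.hom_mult)
  have HF: "subst H (F i) = Var i" if "i < n" for i
  proof -
    have "subst H (F i) = subst z (subst K (subst X (F i)))"
      unfolding subst_subst H_def by simp
    also have "subst K (subst X (F i)) = \<kappa> * (Const u * Var i - Var (n + i))"
      using that by (simp add: FX_eq subst.hom_mult subst.hom_minus K(3))
    also have "subst z \<dots> = Var i"
      using that by (simp add: subst.hom_mult subst.hom_minus z_def coord)
    finally show ?thesis .
  qed
  \<comment> \<open>For the other composition, \<open>b\<close> is chosen as the value of
    \<open>Y\<close> that makes \<open>A\<close> vanish at \<open>X = Var\<close>. Along the
    resulting point \<open>e\<close>, the map \<open>G\<close> takes the value \<open>z\<close> at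
    \<open>F\<close>.\<close>
  define b where "b j = (\<Sum>l<n. subst Var (W l j) * (- pd l f))" for j
  define e where "e = pt Var b"
  have id: "subst Var p = p" for p :: "'a mpoly" by (rule subst_id[OF subset_UNIV]) simp
  have eX: "subst e (X j) = Var j" and eY: "subst e (Y j) = b j" if "j < n" for j
    using that by (simp_all add: e_def subst_pt_X subst_pt_Y)
  have eA: "subst e (A i) = 0" if "i < n" for i
  proof -
    have "subst e (A i) = subst Var (pd i f) + (\<Sum>j<n. subst e (Y j) * subst Var (pd i (F j)))"
      by (rule subst_A) (use eX that in auto)
    also have "(\<Sum>j<n. subst e (Y j) * subst Var (pd i (F j)))
        = (\<Sum>j<n. (\<Sum>l<n. subst Var (W l j) * (- pd l f)) * subst Var (pd i (F j)))"
      by (intro sum.cong refl) (simp add: eY b_def)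
    also have "\<dots> = - pd i f" by (rule sum_W_solve[OF that])
    finally show ?thesis by (simp add: id)
  qed
  have eF: "subst e (subst X (F i)) = F i" if "i < n" for i
    using subst_subst_X[OF eX vars_F[OF that]] by (simp add: id)
  have eG: "subst e (G v) = subst F (z v)" if "v < n + n" for v
  proof (cases "v < n")
    case True
    then show ?thesis by (simp add: G_x subst.hom_add eA eF z_def)
  next
    case False
    define w where "w = v - n"
    have v: "v = n + w" "w < n" using False that by (auto simp: w_def)
    then show ?thesis by (simp add: G_y subst.hom_add subst.hom_mult eA eF z_def)
  qed
  have vKX: "vars (subst K (X j)) \<subseteq> {..<n + n}" if "j < n" for j
    unfolding KX using that by (intro vars_le vK) auto
  have FH: "subst F (H j) = Var j" if "j < n" for j
  proof -
    have "subst F (H j) = subst (\<lambda>v. subst F (z v)) (subst K (X j))"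
      unfolding H_def by (rule subst_subst)
    also have "\<dots> = subst (\<lambda>v. subst e (G v)) (subst K (X j))"
      by (rule subst_cong[OF vKX[OF that]]) (simp add: eG)
    also have "\<dots> = subst e (subst G (subst K (X j)))" by (simp only: subst_subst)
    also have "subst G (subst K (X j)) = X j"
      using that by (simp add: KX subst.hom_add subst.hom_mult K(2)) (simp add: X_def)
    finally show ?thesis using eX[OF that] by simp
  qed
  have "vars (H j) \<subseteq> {..<n}" if "j < n" for j
    unfolding H_def
  proof (rule vars_subst[OF vKX[OF that]])
    fix v assume v: "v \<in> {..<n + n}"
    show "vars (z v) \<subseteq> {..<n}"
    proof (cases "v < n")
      case False
      then have "vars (Const u' * Var (v - n)) \<subseteq> {..<n}" using v by (intro vars_le) auto
      with False show ?thesis by (simp add: z_def)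
    qed (simp add: z_def)
  qed
  then show ?thesis
    unfolding invertible_polymap_def polymap_def using vars_F HF FH by blast
qed

end

section \<open>Irreducibility of the components by degree in \<open>Y\<close>\<close>

context gradient_map
begin

text \<open>In the coordinates \<open>X\<close>, \<open>Y\<close>, the homomorphism \<open>ypoly\<close> scales \<open>Y\<close> by the polynomial
  variable, so that its degree is the degree in \<open>Y\<close>.\<close>

definition yvar :: "nat \<Rightarrow> 'a mpoly poly" where
  "yvar v = (if v < n then [:- (\<kappa> * Const u' * X v), \<kappa> * Const u * Y v:]
     else if v < n + n then [:\<kappa> * X (v - n), - (\<kappa> * Y (v - n)):] else [:Var v:])"

definition ypoly :: "'a mpoly \<Rightarrow> 'a mpoly poly" where
  "ypoly = ev (\<lambda>c. [:Const c:]) yvar"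

sublocale ypoly: comm_ring_hom ypoly
  unfolding ypoly_def by (rule const_poly.ev_hom)

lemma ypoly_Const [simp]: "ypoly (Const c) = [:Const c:]"
  and ypoly_Var [simp]: "ypoly (Var v) = yvar v"
  by (simp_all add: ypoly_def)

lemma ypoly_X: "j < n \<Longrightarrow> ypoly (X j) = [:X j:]"
  and ypoly_Y: "j < n \<Longrightarrow> ypoly (Y j) = [:0, Y j:]"
proof -
  assume j: "j < n"
  have e: "(Const u - Const u') * \<kappa> * z = z" for z using \<kappa> by simp
  have "\<kappa> * X j * Const u - \<kappa> * Const u' * X j = X j"
    by (rule trans[OF _ e[of "X j"]]) (simp add: algebra_simps)
  moreover have "ypoly (X j) = yvar j + [:Const u:] * yvar (n + j)"
    by (simp only: X_def ypoly.hom_add ypoly.hom_mult ypoly_Const ypoly_Var)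
  ultimately show "ypoly (X j) = [:X j:]" using j by (simp add: yvar_def mult_ac)
  have "\<kappa> * Const u * Y j - \<kappa> * Y j * Const u' = Y j"
    by (rule trans[OF _ e[of "Y j"]]) (simp add: algebra_simps)
  moreover have "ypoly (Y j) = yvar j + [:Const u':] * yvar (n + j)"
    by (simp only: Y_def ypoly.hom_add ypoly.hom_mult ypoly_Const ypoly_Var)
  ultimately show "ypoly (Y j) = [:0, Y j:]" using j by (simp add: yvar_def mult_ac)
qed

lemma ypoly_subst_X:
  assumes "vars p \<subseteq> {..<n}"
  shows "ypoly (subst X p) = [:subst X p:]"
  using assms
  by (induction p rule: mpoly_induct)
    (simp_all add: ypoly_X subst.hom_add subst.hom_mult ypoly.hom_add ypoly.hom_mult)

lemma poly_ypoly_1: "poly (ypoly p) 1 = p"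
proof -
  have v: "poly (yvar v) 1 = Var v" for v
  proof -
    have "poly (yvar v) 1 = pt X Y v" if "v < n + n"
      using that by (simp add: yvar_def pt_def algebra_simps)
    then show ?thesis using pt_X_Y[of v] by (cases "v < n + n") (simp_all add: yvar_def)
  qed
  have "poly (ypoly p) 1 = p" if "vars p \<subseteq> UNIV"
    using that by (induction p rule: mpoly_induct) (simp_all add: v ypoly.hom_add ypoly.hom_mult)
  then show ?thesis by simp
qed

text \<open>The derivation \<open>\<partial>/\<partial>Y\<^sub>k\<close>, up to a constant factor.\<close>

definition dY :: "nat \<Rightarrow> 'a mpoly \<Rightarrow> 'a mpoly" where
  "dY k p = Const u * pd k p - pd (n + k) p"

lemma dY_add: "dY k (p + q) = dY k p + dY k q"
  by (simp add: dY_def pd_add algebra_simps)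

lemma dY_mult: "dY k (p * q) = dY k p * q + p * dY k q"
  by (simp add: dY_def pd_mult algebra_simps)

lemma dY_Const [simp]: "dY k (Const c) = 0"
  by (simp add: dY_def)

lemma dY_sum: "dY k (sum h I) = (\<Sum>i\<in>I. dY k (h i))"
  by (simp add: dY_def pd_sum sum_distrib_left sum_subtractf)

lemma dY_X: "k < n \<Longrightarrow> j < n \<Longrightarrow> dY k (X j) = 0"
  by (simp add: dY_def pd_X)

lemma dY_Y: "k < n \<Longrightarrow> j < n \<Longrightarrow> dY k (Y j) = (if k = j then Const (u - u') else 0)"
  by (simp add: dY_def pd_Y Const.hom_minus)

lemma dY_subst_X: "k < n \<Longrightarrow> vars p \<subseteq> {..<n} \<Longrightarrow> dY k (subst X p) = 0"
  by (simp add: dY_def pd_subst_X)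

text \<open>Such a \<open>P\<close> equals its value at \<open>Y = 0\<close>, and setting
  \<open>Y = 0\<close> sends every variable to something that \<open>dY k\<close> annihilates: a
  multiple of some \<open>X j\<close>, or a variable outside the first \<open>2n\<close>.\<close>

lemma dY_eq_0_if_degree_0:
  assumes "degree (ypoly P) = 0" "k < n"
  shows "dY k P = 0"
proof -
  obtain p where p: "ypoly P = [:p:]" using assms(1) by (metis degree_eq_zeroE)
  have "P = p" using poly_ypoly_1[of P] p by simp
  then have "P = poly (ypoly P) 0" using p by simp
  moreover have "dY k (poly (ypoly q) 0) = 0" if "vars q \<subseteq> UNIV" for q
    using that
  proof (induction q rule: mpoly_induct)
    case (Var v)
    have \<kappa>0: "dY k \<kappa> = 0" by (simp add: \<kappa>_def)
    consider "v < n" | "\<not> v < n" "v - n < n" | "n + n \<le> v" by linarith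
    then show ?case
    proof cases
      case 1
      have "dY k (- (\<kappa> * Const u' * X v)) = dY k (Const (- u') * \<kappa> * X v)"
        by (simp add: Const.hom_uminus mult_ac)
      with 1 assms(2) show ?thesis by (simp add: yvar_def dY_mult dY_X \<kappa>0)
    next
      case 2
      with assms(2) show ?thesis by (simp add: yvar_def dY_mult dY_X \<kappa>0)
    next
      case 3
      with assms(2) show ?thesis by (simp add: yvar_def dY_def pd_Var)
    qed
  qed (simp_all add: ypoly.hom_add ypoly.hom_mult dY_add dY_mult)
  ultimately show ?thesis by (metis subset_UNIV)
qed

text \<open>In a factorisation one factor has \<open>Y\<close>-degree zero and so divides the part
  \<open>w\<close> linear in \<open>Y\<close>, whose coefficients form a unimodular row. General
  \<open>\<alpha>\<close> and \<open>\<beta>\<close> treat \<open>G i\<close> and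
  \<open>G (n + i)\<close> together.\<close>

lemma irreducible_component:
  assumes i: "i < n" and \<alpha>: "\<alpha> \<noteq> 0"
  shows "irreducible (Const \<alpha> * A i + Const \<beta> * subst X (F i))"
proof -
  define p where "p = Const \<alpha> * A i + Const \<beta> * subst X (F i)"
  define h where "h = Const \<alpha> * subst X (pd i f) + Const \<beta> * subst X (F i)"
  define w where "w = Const \<alpha> * (\<Sum>j<n. Y j * subst X (pd i (F j)))"
  have sum_linear_poly: "(\<Sum>j\<in>I. [:0, q j:]) = [:0, sum q I:]" for I and q :: "nat \<Rightarrow> 'a mpoly"
    by (induction I rule: infinite_finite_induct) simp_all
  have "ypoly (\<Sum>j<n. Y j * subst X (pd i (F j))) = (\<Sum>j<n. [:0, Y j * subst X (pd i (F j)):])"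
    unfolding ypoly.hom_sum ypoly.hom_mult
    by (intro sum.cong refl) (simp add: ypoly_Y ypoly_subst_X vars_pd_F mult.commute)
  also have "\<dots> = [:0, \<Sum>j<n. Y j * subst X (pd i (F j)):]"
    by (rule sum_linear_poly)
  finally have yp: "ypoly p = [:h, w:]"
    using i unfolding p_def A_def h_def w_def
    by (simp add: ypoly.hom_add ypoly.hom_mult ypoly_subst_X vars_pd_f vars_F)
  have dw: "dY k w = Const (\<alpha> * (u - u')) * subst X (pd i (F k))" if "k < n" for k
  proof -
    have "dY k w = Const \<alpha> * (\<Sum>j<n. if j = k then Const (u - u') * subst X (pd i (F j)) else 0)"
      unfolding w_def dY_mult dY_sum using that
      by (simp add: dY_Y dY_subst_X vars_pd_F if_distrib if_distribR cong: if_cong)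
    then show ?thesis using that by (simp add: Const.hom_mult mult.assoc)
  qed
  \<comment> \<open>\<open>dY k\<close> acts on \<open>w = P * q\<close> only through
    \<open>q\<close>, so \<open>P\<close> divides each \<open>dY k w\<close>, a nonzero constant
    times a coefficient of the row; combining the row with \<open>W\<close> gives 1.\<close>
  have unit: "P dvd 1" if P: "P dvd w" and "degree (ypoly P) = 0" for P
  proof -
    obtain q where q: "w = P * q" using P unfolding dvd_def by blast
    have "P dvd subst X (pd i (F k))" if "k < n" for k
    proof -
      have "dY k w = P * dY k q"
        using dY_eq_0_if_degree_0[OF \<open>degree (ypoly P) = 0\<close> that] by (simp add: q dY_mult)
      then have "P dvd Const (\<alpha> * (u - u')) * subst X (pd i (F k))" unfolding dw[OF that] by simp
      moreover have "\<alpha> * (u - u') \<noteq> 0" using \<alpha> u_neq by simp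
      ultimately show ?thesis by (rule dvd_Const_mult_cancel)
    qed
    then have "P dvd (\<Sum>k<n. subst X (W i k) * subst X (pd i (F k)))"
      by (intro dvd_sum dvd_mult) simp
    also have "(\<Sum>k<n. subst X (W i k) * subst X (pd i (F k)))
        = subst X (\<Sum>k<n. W i k * pd i (F k))"
      by (simp only: subst.hom_sum subst.hom_mult)
    also have "\<dots> = 1" using W_left[OF i i] by simp
    finally show ?thesis .
  qed
  have w0: "w \<noteq> 0"
  proof
    assume "w = 0"
    then have "subst X (pd i (F k)) = 0" if "k < n" for k
      using dw[OF that] \<alpha> u_neq by (simp add: dY_def)
    then have "subst X (\<Sum>k<n. W i k * pd i (F k)) = 0"
      by (simp add: subst.hom_sum subst.hom_mult)
    then show False using W_left[OF i i] by simp
  qed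
  have key: "P dvd 1" if PQ: "p = P * Q" and dP: "degree (ypoly P) = 0" for P Q
  proof -
    obtain a where a: "ypoly P = [:a:]" using dP by (metis degree_eq_zeroE)
    then have "a = P" using poly_ypoly_1[of P] by simp
    with a have "[:h, w:] = [:P:] * ypoly Q" by (simp flip: yp add: PQ ypoly.hom_mult)
    then have "coeff [:h, w:] 1 = coeff ([:P:] * ypoly Q) 1" by (simp only:)
    then have "w = P * coeff (ypoly Q) 1" by simp
    then show ?thesis by (intro unit dP) simp
  qed
  have p0: "p \<noteq> 0" using yp w0 by auto
  have "irreducible p"
  proof (rule irreducibleI)
    show "p \<noteq> 0" by (fact p0)
    show "\<not> p dvd 1"
    proof
      assume "p dvd 1"
      then obtain c where "p = Const c" by (auto simp: dvd_1_iff_Const)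
      then have "[:h, w:] = [:Const c:]" using yp by simp
      then show False using w0 by simp
    qed
    fix P Q assume PQ: "p = P * Q"
    have "ypoly P \<noteq> 0" "ypoly Q \<noteq> 0" using p0 PQ poly_ypoly_1[of P] poly_ypoly_1[of Q] by auto
    then have "degree (ypoly P) + degree (ypoly Q) = degree (ypoly p)"
      unfolding PQ ypoly.hom_mult by (simp add: degree_mult_eq)
    also have "\<dots> = 1" using w0 by (simp add: yp)
    finally consider "degree (ypoly P) = 0" | "degree (ypoly Q) = 0" by linarith
    then show "P dvd 1 \<or> Q dvd 1"
    proof cases
      case 1
      with PQ have "P dvd 1" by (rule key)
      then show ?thesis ..
    next
      case 2
      have "p = Q * P" using PQ by (simp only: mult.commute)
      then have "Q dvd 1" using 2 by (rule key)
      then show ?thesis ..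
    qed
  qed
  then show ?thesis by (simp add: p_def)
qed

end

theorem theorem3p3:
  fixes dummy :: "'a::field_char_0"
  shows
  "(\<forall>(n::nat) (G :: nat \<Rightarrow> 'a mpoly) i.
      keller n G \<and> jac_symmetric n G \<and> i < n \<and> pd i (homog_part 1 (G i)) \<noteq> 0 \<longrightarrow>
        ((\<exists>d. homogeneous d (G i - homog_part 1 (G i))) \<longrightarrow> irreducible (G i)) \<and>
        (homogeneous 3 (G i - homog_part 1 (G i)) \<longrightarrow> (\<forall>c. irreducible (G i + Const c))))
   \<and>
   (\<forall>(n::nat) (G :: nat \<Rightarrow> 'a mpoly) (f :: 'a mpoly) (F :: nat \<Rightarrow> 'a mpoly) (u::'a) (u'::'a).
      n \<ge> 1 \<and> keller (2*n) G \<and> jac_symmetric (2*n) G \<and> u \<noteq> 0 \<and>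
      vars f \<subseteq> {..<n} \<and> (\<forall>j<n. vars (F j) \<subseteq> {..<n}) \<and>
      (\<forall>i<2*n. G i = pd i (
         subst (\<lambda>j. Var j + Const u * Var (n + j)) f +
         (\<Sum>j<n. (Var j + Const u' * Var (n + j)) *
                  subst (\<lambda>j. Var j + Const u * Var (n + j)) (F j)))) \<longrightarrow>
        (\<forall>i<2*n. irreducible (G i)) \<and> u \<noteq> u' \<and> keller n F \<and>
        (invertible_polymap n F \<longleftrightarrow> invertible_polymap (2*n) G))"
proof (intro conjI allI impI; elim conjE)
  fix n i and G :: "nat \<Rightarrow> 'a mpoly"
  assume G: "keller n G" "jac_symmetric n G" "i < n" "pd i (homog_part 1 (G i)) \<noteq> 0"
  assume "\<exists>d. homogeneous d (G i - homog_part 1 (G i))"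
  then obtain d where "homogeneous d (G i - homog_part 1 (G i))" ..
  with G show "irreducible (G i)" by (rule irreducible_linear_plus_homogeneous)
next
  fix n i c and G :: "nat \<Rightarrow> 'a mpoly"
  assume "keller n G" "jac_symmetric n G" "i < n" "pd i (homog_part 1 (G i)) \<noteq> 0"
    "homogeneous 3 (G i - homog_part 1 (G i))"
  then show "irreducible (G i + Const c)" by (rule irreducible_linear_plus_cubic)
next
  fix n and G F :: "nat \<Rightarrow> 'a mpoly" and f and u u' :: 'a
  assume n: "n \<ge> 1" and keller: "keller (2*n) G" and u: "u \<noteq> 0"
    and f: "vars f \<subseteq> {..<n}" and F: "\<forall>j<n. vars (F j) \<subseteq> {..<n}"
    and G: "\<forall>i<2*n. G i = pd i (
         subst (\<lambda>j. Var j + Const u * Var (n + j)) f +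
         (\<Sum>j<n. (Var j + Const u' * Var (n + j)) *
                  subst (\<lambda>j. Var j + Const u * Var (n + j)) (F j)))"
  interpret gf: gradient_form n f F u u' using f F by unfold_locales auto
  have g: "gf.g = subst (\<lambda>j. Var j + Const u * Var (n + j)) f +
         (\<Sum>j<n. (Var j + Const u' * Var (n + j)) *
                  subst (\<lambda>j. Var j + Const u * Var (n + j)) (F j))"
    by (simp add: gf.g_def gf.X_def[abs_def] gf.Y_def[abs_def])
  have G_g: "G i = pd i gf.g" if "i < 2 * n" for i
    unfolding g using G that by blast
  have Gx: "G i = gf.A i + subst gf.X (F i)" if "i < n" for i
    using G_g[of i] gf.pd_g(1)[OF that] that by simp
  have Gy: "G (n + i) = Const u * gf.A i + Const u' * subst gf.X (F i)" if "i < n" for i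
    using G_g[of "n + i"] gf.pd_g(2)[OF that] that by simp
  obtain c where c: "c \<noteq> 0" "jac_det (n + n) G = Const c"
    using keller by (auto simp: keller_def mult_2)
  have det: "Const c = (- (Const (u' - u) ^ 2)) ^ n * subst gf.X (jac_det n F) ^ 2"
    using gf.jac_det_gradient[of G] Gx Gy c(2) by simp
  have neq: "u \<noteq> u'" and kF: "keller n F"
    by (rule gf.jacobian_F_if_keller[OF n c(1) det])+
  interpret gradient_map n f F u u' G
    using neq kF Gx Gy by unfold_locales auto
  show "u \<noteq> u'" "keller n F" by (fact neq, fact kF)
  show "invertible_polymap n F \<longleftrightarrow> invertible_polymap (2 * n) G"
    using invertible_gradient_if invertible_if_gradient by (auto simp: mult_2)
  fix i assume that: "i < 2 * n"
  show "irreducible (G i)"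
  proof (cases "i < n")
    case True
    then show ?thesis using irreducible_component[OF True, of 1 1] by (simp add: Gx)
  next
    case False
    define k where "k = i - n"
    have i: "i = n + k" "k < n" using False that by (auto simp: k_def)
    \<comment> \<open>For the \<open>y\<close>-components the coefficient of \<open>A\<close> is
      \<open>u\<close>; here \<open>u \<noteq> 0\<close> enters.\<close>
    show ?thesis using irreducible_component[OF i(2) u, of u'] by (simp add: i(1) Gy i(2))
  qed
qed

end
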